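(* Let $T>0$, $d,m\ge1$, $\gamma\in(\tfrac12,1]$, and let $g\in C^{\gamma}([0,T];\mathbb R^m)$. Let $x(0)\in\mathbb R^d$ with $x^i(0)>0$ for $i=1,\dots,d$. Let $\sigma:[0,T]\times\mathbb R^d\to\mathbb R^{d\times m}$ and $b:[0,T]\times\mathbb R^d\to\mathbb R^d$ be bounded, and suppose there are constants $K_0$ and $\nu\ge\gamma$ such that for all $x,y\in\mathbb R^d$ and all $s,t\in[0,T]$: $$|\sigma(t,x)-\sigma(t,y)|\le K_0|x-y|,\qquad |\sigma(t,x)-\sigma(s,x)|\le K_0|t-s|^{\nu},\qquad |b(t,x)-b(t,y)|\le K_0|x-y|.$$ Let $\lambda\in(\tfrac12,\gamma)$. Then the equation $$x(t)=x(0)+\int_0^t b(s,x(s))\,ds+\int_0^t\sigma(s,x(s))\,dg_s+y(t),\qquad t\in(0,T],$$ where $$y^i(t)=\max_{s\in[0,t]}\big(z^i(s)\big)^-\ (i=1,\dots,d),\qquad z(t)=x(0)+\int_0^t b(s,x(s))\,ds+\int_0^t\sigma(s,x(s))\,dg_s,\qquad t\in[0,T],$$ has a solution $x\in C^{\lambda}([0,T];\mathbb R^d_+)$.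
   Context: $\mathbb R^d_+$ is the set of vectors in $\mathbb R^d$ with non-negative components. For $0<\lambda\le 1$, $C^\lambda([0,T];V)$ is the space of $V$-valued functions $f$ on $[0,T]$ with $\sup_{0\le u<v\le T}\frac{|f(v)-f(u)|}{(v-u)^\lambda}<\infty$. For real $a$, $a^-=\max(-a,0)$. The integral with respect to $g$ is a Young integral, i.e. the limit of Riemann–Stieltjes sums as the mesh tends to zero, which exists when the integrand is $\lambda$-Hölder and the integrator is $\gamma$-Hölder with $\lambda+\gamma>1$.
   Formalization: It is additionally assumed that t ↦ b(t,x) is Lebesgue measurable on [0,T] for each fixed x; without this the integral of b(s,x(s)) ds need not exist (e.g. b the indicator of a non-measurable set of times). *)

theory Defs
  imports "HOL-Analysis.Analysis"
begin

definition nonneg_orthant :: "(real ^ 'd) set" where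
  "nonneg_orthant = {v. \<forall>i. 0 \<le> v $ i}"

text \<open>Functions are total on \<open>real\<close>; only their restriction to \<open>{0..T}\<close> matters.\<close>

definition holder_space :: "real \<Rightarrow> real \<Rightarrow> 'v::real_normed_vector set \<Rightarrow> (real \<Rightarrow> 'v) set" where
  "holder_space l T V =
     {f. f ` {0..T} \<subseteq> V \<and>
         bdd_above {norm (f v - f u) / (v - u) powr l | u v. 0 \<le> u \<and> u < v \<and> v \<le> T}}"

text \<open>Riemann--Stieltjes sums over tagged divisions into compact intervals. Degenerate
  one-point pieces are allowed by \<^const>\<open>tagged_division_of\<close>; they contribute 0.\<close>

definition rs_sum ::
  "(real \<Rightarrow> real ^ 'm ^ 'd) \<Rightarrow> (real \<Rightarrow> real ^ 'm) \<Rightarrow> (real \<times> real set) set \<Rightarrow> real ^ 'd" where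
  "rs_sum f g p = (\<Sum>(s, k)\<in>p. f s *v (g (Sup k) - g (Inf k)))"

definition has_young_integral ::
  "(real \<Rightarrow> real ^ 'm ^ 'd) \<Rightarrow> (real \<Rightarrow> real ^ 'm) \<Rightarrow> real \<Rightarrow> real \<Rightarrow> real ^ 'd \<Rightarrow> bool" where
  "has_young_integral f g a b I \<longleftrightarrow>
     (\<forall>e>0. \<exists>\<delta>>0. \<forall>p. p tagged_division_of {a..b} \<and> (\<forall>(s, k)\<in>p. Sup k - Inf k < \<delta>)
        \<longrightarrow> norm (rs_sum f g p - I) < e)"

definition young_integrable ::
  "(real \<Rightarrow> real ^ 'm ^ 'd) \<Rightarrow> (real \<Rightarrow> real ^ 'm) \<Rightarrow> real \<Rightarrow> real \<Rightarrow> bool" where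
  "young_integrable f g a b \<longleftrightarrow> (\<exists>I. has_young_integral f g a b I)"

definition young_integral ::
  "(real \<Rightarrow> real ^ 'm ^ 'd) \<Rightarrow> (real \<Rightarrow> real ^ 'm) \<Rightarrow> real \<Rightarrow> real \<Rightarrow> real ^ 'd" where
  "young_integral f g a b = (THE I. has_young_integral f g a b I)"

lemma small_mesh_division_exists:
  fixes a b \<delta> :: real
  assumes "\<delta> > 0"
  obtains p where "p tagged_division_of {a..b}" "\<forall>(s, k)\<in>p. Sup k - Inf k < \<delta>"
proof -
  have "gauge (\<lambda>x::real. ball x (\<delta> / 2))"
    using assms by (intro gauge_ball) auto
  then obtain p where p: "p tagged_division_of {a..b}" "(\<lambda>x. ball x (\<delta> / 2)) fine p"
    using fine_division_exists_real by blast
  have "Sup k - Inf k < \<delta>" if sk: "(s, k) \<in> p" for s k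
  proof -
    obtain c d where k: "k = {c..d}" "s \<in> k"
      using tagged_division_ofD(2,4)[OF p(1) sk] by (metis box_real(2))
    have "k \<subseteq> ball s (\<delta> / 2)"
      using p(2) sk unfolding fine_def by blast
    moreover have "c \<in> k" "d \<in> k" "c \<le> d" using k by auto
    ultimately have "dist s c < \<delta> / 2" "dist s d < \<delta> / 2" by auto
    then show ?thesis using k \<open>c \<le> d\<close> by (auto simp: dist_real_def)
  qed
  then show thesis using that p(1) by blast
qed

lemma has_young_integral_unique:
  assumes "has_young_integral f g a b I" "has_young_integral f g a b J"
  shows "I = J"
proof (rule ccontr)
  assume "I \<noteq> J"
  then have e: "norm (I - J) / 2 > 0" by simp
  obtain \<delta>1 where d1: "\<delta>1 > 0" "\<And>p. p tagged_division_of {a..b} \<and> (\<forall>(s, k)\<in>p. Sup k - Inf k < \<delta>1)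
        \<longrightarrow> norm (rs_sum f g p - I) < norm (I - J) / 2"
    using assms(1) e unfolding has_young_integral_def by meson
  obtain \<delta>2 where d2: "\<delta>2 > 0" "\<And>p. p tagged_division_of {a..b} \<and> (\<forall>(s, k)\<in>p. Sup k - Inf k < \<delta>2)
        \<longrightarrow> norm (rs_sum f g p - J) < norm (I - J) / 2"
    using assms(2) e unfolding has_young_integral_def by meson
  obtain p where p: "p tagged_division_of {a..b}" "\<forall>(s, k)\<in>p. Sup k - Inf k < min \<delta>1 \<delta>2"
    using small_mesh_division_exists[of "min \<delta>1 \<delta>2"] d1(1) d2(1) by auto
  have "norm (rs_sum f g p - I) < norm (I - J) / 2" using p by (intro d1(2)[rule_format]) auto
  moreover have "norm (rs_sum f g p - J) < norm (I - J) / 2" using p by (intro d2(2)[rule_format]) auto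
  ultimately show False
    using norm_triangle_ineq4[of "rs_sum f g p - J" "rs_sum f g p - I"] by simp
qed

lemma young_integral_eq: "has_young_integral f g a b I \<Longrightarrow> young_integral f g a b = I"
  unfolding young_integral_def using has_young_integral_unique by blast

definition neg_part :: "real \<Rightarrow> real" where
  "neg_part a = max (- a) 0"

text \<open>\<^const>\<open>Max\<close> is meaningful only for finite sets, so attained maxima of arbitrary sets of
  reals are described by a predicate.\<close>

definition is_maximum :: "real set \<Rightarrow> real \<Rightarrow> bool" where
  "is_maximum S v \<longleftrightarrow> v \<in> S \<and> (\<forall>u\<in>S. u \<le> v)"

text \<open>The integrability clauses make sure that all integrals in the equation really exist, so that
  the total operators \<^const>\<open>integral\<close> and \<^const>\<open>young_integral\<close> are never used outside their
  domain. The integral in \<open>ds\<close> is a Lebesgue integral.\<close>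

definition reflected_solution ::
  "real \<Rightarrow> (real \<Rightarrow> real ^ 'd \<Rightarrow> real ^ 'd) \<Rightarrow> (real \<Rightarrow> real ^ 'd \<Rightarrow> real ^ 'm ^ 'd) \<Rightarrow>
   (real \<Rightarrow> real ^ 'm) \<Rightarrow> real ^ 'd \<Rightarrow> (real \<Rightarrow> real ^ 'd) \<Rightarrow> bool" where
  "reflected_solution T b \<sigma> g x0 x \<longleftrightarrow>
     x 0 = x0 \<and>
     (\<lambda>s. b s (x s)) absolutely_integrable_on {0..T} \<and>
     (\<forall>t\<in>{0..T}. young_integrable (\<lambda>s. \<sigma> s (x s)) g 0 t) \<and>
     (\<exists>y z.
        (\<forall>t\<in>{0<..T}.
           x t = x0 + integral {0..t} (\<lambda>s. b s (x s))
                    + young_integral (\<lambda>s. \<sigma> s (x s)) g 0 t + y t) \<and>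
        (\<forall>t\<in>{0..T}. \<forall>i. is_maximum ((\<lambda>s. neg_part (z s $ i)) ` {0..t}) (y t $ i)) \<and>
        (\<forall>t\<in>{0..T}.
           z t = x0 + integral {0..t} (\<lambda>s. b s (x s))
                    + young_integral (\<lambda>s. \<sigma> s (x s)) g 0 t))"

end

(* Freeze the state at xi on [u,v]: the increment of the unreflected process is approximated by the
   germ A u v xi = int_u^v b(s,xi) ds + sigma(u,xi) (g v - g u).  Its failure to be additive is of
   order (v-u)^(2 gamma) with 2 gamma > 1, so a discrete sewing argument compares the reflected
   Euler scheme with the germ, uniformly in the step.  The running maximum does not increase
   oscillations, hence this gives a uniform gamma-Hoelder bound on windows of a fixed length;
   boundedness of the coefficients makes that length independent of the position.  A limit point
   of the schemes still satisfies |z v - z u - A u v (x u)| <= C (v-u)^(2 gamma), and this estimate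
   alone identifies z as x0 plus the Lebesgue and Young integrals, since the errors summed over a
   division of small mesh tend to zero. *)
theory Submission
  imports Defs "HOL-Complex_Analysis.Great_Picard"
begin

subsection \<open>Sewing and compactness\<close>

text \<open>The obstacle is the reflection: the map from \<open>z\<close> to its running maximum is
  nonexpansive for the sup norm but not Lipschitz for Hoelder seminorms, and Young estimates live in
  the latter. Contraction in a Hoelder space is therefore out of reach, and existence is drawn from
  compactness of an explicit scheme. Two properties of the map suffice: it respects oscillation over
  a window (a priori bound) and it is sup-norm continuous (limit). The a priori bound closes on
  itself because the unknown Hoelder constant \<open>M\<close> enters the remainder only through the
  product \<open>M * \<Delta> powr \<gamma>\<close>, while the leading constant \<open>C1\<close> is
  free of \<open>M\<close>. All estimates are made at the exponent \<open>\<gamma>\<close> of the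
  integrator, which needs only \<open>2 * \<gamma> > 1\<close>; the exponent \<open>l\<close>
  appears only when the local bound is turned into membership in the Hoelder space.\<close>

lemma norm_matrix_vector_mult_le:
  fixes A :: "real ^ 'm ^ 'd"
  shows "norm (A *v x) \<le> norm A * norm x"
proof -
  have "norm (A *v x) = L2_set (\<lambda>i. \<bar>A $ i \<bullet> x\<bar>) UNIV"
    by (simp add: norm_vec_def matrix_vector_mul_component)
  also have "\<dots> \<le> L2_set (\<lambda>i. norm (A $ i) * norm x) UNIV"
    by (intro L2_set_mono) (auto intro: Cauchy_Schwarz_ineq2)
  also have "\<dots> = norm A * norm x"
    by (simp add: norm_vec_def L2_set_left_distrib)
  finally show ?thesis .
qed

text \<open>Superadditivity alone gives the factor 1. As neither part exceeds two thirds of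
  \<open>n\<close>, the surplus power \<open>\<theta> - 1\<close> of each part gains a fixed factor
  below 1, and this gain per cut is what makes sewing errors summable.\<close>

lemma powr_sum_le_balanced:
  fixes p q n \<theta> :: real
  assumes "1 < \<theta>" "0 < p" "0 < q" "p + q = n" "3 * p \<le> 2 * n" "3 * q \<le> 2 * n"
  shows "p powr \<theta> + q powr \<theta> \<le> (2/3) powr (\<theta> - 1) * n powr \<theta>"
proof -
  have *: "r powr \<theta> \<le> r * ((2/3) powr (\<theta> - 1) * n powr (\<theta> - 1))"
    if "0 < r" "3 * r \<le> 2 * n" for r
  proof -
    have "r powr \<theta> = r * r powr (\<theta> - 1)"
      using that by (simp add: powr_diff)
    also have "\<dots> \<le> r * ((2/3) * n) powr (\<theta> - 1)"
      using that assms by (intro mult_left_mono powr_mono2) auto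
    also have "\<dots> = r * ((2/3) powr (\<theta> - 1) * n powr (\<theta> - 1))"
      using that by (subst powr_mult) auto
    finally show ?thesis .
  qed
  have "p powr \<theta> + q powr \<theta> \<le> (p + q) * ((2/3) powr (\<theta> - 1) * n powr (\<theta> - 1))"
    using *[OF assms(2,5)] *[OF assms(3,6)] unfolding distrib_right by linarith
  also have "\<dots> = (2/3) powr (\<theta> - 1) * (n * n powr (\<theta> - 1))"
    using assms by simp
  also have "n * n powr (\<theta> - 1) = n powr \<theta>"
    using assms by (simp add: powr_diff)
  finally show ?thesis .
qed

text \<open>The sum of the geometric series whose ratio is the gain per cut; equivalently the
  solution of \<open>C = C * ratio + 1\<close>, the balance needed in the induction for
  \<open>discrete_sewing\<close>.\<close>

definition sewing_const :: "real \<Rightarrow> real" where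
  "sewing_const \<theta> = 1 / (1 - (2/3) powr (\<theta> - 1))"

lemma two_thirds_powr_less_one: "1 < \<theta> \<Longrightarrow> (2/3 :: real) powr (\<theta> - 1) < 1"
  using powr_less_mono2[of "\<theta> - 1" "2/3 :: real" 1] by simp

lemma sewing_const_pos: "1 < \<theta> \<Longrightarrow> 0 < sewing_const \<theta>"
  using two_thirds_powr_less_one by (simp add: sewing_const_def)

lemma sewing_const_eq:
  assumes "1 < \<theta>"
  shows "sewing_const \<theta> * (2/3) powr (\<theta> - 1) + 1 = sewing_const \<theta>"
proof -
  have "c < 1 \<Longrightarrow> 1 / (1 - c) * c + 1 = 1 / (1 - c)" for c :: real
    by (simp add: field_simps)
  then show ?thesis
    using two_thirds_powr_less_one[OF assms] unfolding sewing_const_def by blast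
qed

text \<open>Bisection of the index interval: by induction the two halves use up the share
  \<open>ratio\<close> of the bound, and the cost \<open>D\<close> of the cut fills the rest
  exactly. The number of points does not enter the constant, which is why the estimate is uniform in
  the step size.\<close>

lemma discrete_sewing:
  fixes r :: "nat \<Rightarrow> nat \<Rightarrow> real"
  assumes \<theta>: "1 < \<theta>" and D: "0 \<le> D"
    and step: "\<And>k. a \<le> k \<Longrightarrow> k < b \<Longrightarrow> r k (Suc k) \<le> 0"
    and split: "\<And>k l m. a \<le> k \<Longrightarrow> k < l \<Longrightarrow> l < m \<Longrightarrow> m \<le> b \<Longrightarrow>
                  r k m \<le> r k l + r l m + D * real (m - k) powr \<theta>"
    and "a \<le> k" "k < m" "m \<le> b"
  shows "r k m \<le> sewing_const \<theta> * D * real (m - k) powr \<theta>"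
  using assms(5-7)
proof (induction "m - k" arbitrary: k m rule: less_induct)
  case less
  let ?C = "sewing_const \<theta>" and ?c = "(2/3 :: real) powr (\<theta> - 1)"
  show ?case
  proof (cases "m = Suc k")
    case True
    have "r k m \<le> 0"
      using step[of k] less.prems True by simp
    also have "0 \<le> ?C * D * real (m - k) powr \<theta>"
      using sewing_const_pos[OF \<theta>] D by simp
    finally show ?thesis .
  next
    case False
    \<comment> \<open>The length is at least 2 here. The least balanced cut is that of length 3 into
      1 and 2, the origin of the number 2/3.\<close>
    define l where "l = k + (m - k) div 2"
    have l: "k < l" "l < m" "3 * (l - k) \<le> 2 * (m - k)" "3 * (m - l) \<le> 2 * (m - k)"
      using less.prems False unfolding l_def by auto
    have pq: "real (l - k) powr \<theta> + real (m - l) powr \<theta> \<le> ?c * real (m - k) powr \<theta>"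
      using l by (intro powr_sum_le_balanced \<theta>) auto
    have "r k m \<le> r k l + r l m + D * real (m - k) powr \<theta>"
      using split[of k l m] l less.prems by simp
    also have "\<dots> \<le> ?C * D * real (l - k) powr \<theta> + ?C * D * real (m - l) powr \<theta>
                    + D * real (m - k) powr \<theta>"
      using less.hyps[of l k] less.hyps[of m l] l less.prems by (intro add_mono) auto
    also have "\<dots> = ?C * D * (real (l - k) powr \<theta> + real (m - l) powr \<theta>) + D * real (m - k) powr \<theta>"
      by (simp add: algebra_simps)
    also have "\<dots> \<le> ?C * D * (?c * real (m - k) powr \<theta>) + D * real (m - k) powr \<theta>"
      using pq sewing_const_pos[OF \<theta>] D by (intro add_right_mono mult_left_mono) auto
    also have "\<dots> = (?C * ?c + 1) * (D * real (m - k) powr \<theta>)"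
      by (simp add: algebra_simps)
    also have "\<dots> = ?C * D * real (m - k) powr \<theta>"
      by (simp add: sewing_const_eq[OF \<theta>])
    finally show ?thesis .
  qed
qed

text \<open>A version of the Arzela--Ascoli theorem for functions that are only equicontinuous in the
  limit, such as step functions whose jumps tend to zero.\<close>

lemma asymptotically_equicontinuous_convergent_subsequence:
  fixes F :: "nat \<Rightarrow> 'a::euclidean_space \<Rightarrow> 'b::euclidean_space"
  assumes S: "compact S"
    and bounded: "\<And>n x. x \<in> S \<Longrightarrow> norm (F n x) \<le> M"
    and equi: "\<And>e. 0 < e \<Longrightarrow> \<exists>d>0. \<exists>N. \<forall>n\<ge>N. \<forall>x\<in>S. \<forall>y\<in>S. dist x y < d \<longrightarrow> dist (F n x) (F n y) < e"
  obtains k f where "strict_mono (k :: nat \<Rightarrow> nat)" "uniform_limit S (\<lambda>n. F (k n)) f sequentially"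
proof -
  obtain R where R: "countable R" "R \<subseteq> S" "S \<subseteq> closure R"
    by (metis separable)
  \<comment> \<open>Diagonal extraction over a countable dense set.\<close>
  obtain k where k: "strict_mono (k :: nat \<Rightarrow> nat)" "\<And>x. x \<in> R \<Longrightarrow> \<exists>l. (\<lambda>n. F (k n) x) \<longlonglongrightarrow> l"
    using function_convergent_subsequence[of R F M] R bounded by blast
  have "uniformly_Cauchy_on S (\<lambda>n. F (k n))"
    unfolding uniformly_Cauchy_on_def
  proof (intro allI impI)
    fix e :: real assume "0 < e"
    then obtain d N where d: "d > 0"
      and N: "\<And>n x y. n \<ge> N \<Longrightarrow> x \<in> S \<Longrightarrow> y \<in> S \<Longrightarrow> dist x y < d \<Longrightarrow> dist (F n x) (F n y) < e/3"
      using equi[of "e/3"] by (metis divide_pos_pos zero_less_numeral)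
    \<comment> \<open>A finite net of points of \<open>R\<close> makes the threshold
      \<open>P\<close> independent of \<open>x\<close>; equicontinuity, available beyond
      \<open>N\<close>, carries the Cauchy property from the net to all of \<open>S\<close>.\<close>
    have "S \<subseteq> (\<Union>c\<in>R. ball c d)"
      using R(3) d by (auto simp: closure_approachable)
    then obtain Q where Q: "Q \<subseteq> R" "finite Q" "S \<subseteq> (\<Union>c\<in>Q. ball c d)"
      using compactE_image[OF S, of R "\<lambda>c. ball c d"] by auto
    have "\<forall>\<^sub>F p in sequentially \<times>\<^sub>F sequentially.
            \<forall>q\<in>Q. dist (F (k (fst p)) q) (F (k (snd p)) q) < e/3"
    proof (intro eventually_ball_finite Q(2) ballI)
      fix q assume "q \<in> Q"
      then have "Cauchy (\<lambda>n. F (k n) q)"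
        using k(2) Q(1) by (auto intro: LIMSEQ_imp_Cauchy)
      then obtain P where "\<And>m n. m \<ge> P \<Longrightarrow> n \<ge> P \<Longrightarrow> dist (F (k m) q) (F (k n) q) < e/3"
        using \<open>0 < e\<close> unfolding Cauchy_def by (metis divide_pos_pos zero_less_numeral)
      then show "\<forall>\<^sub>F p in sequentially \<times>\<^sub>F sequentially. dist (F (k (fst p)) q) (F (k (snd p)) q) < e/3"
        unfolding eventually_prod_sequentially by auto
    qed
    then obtain P where P: "\<And>m n q. m \<ge> P \<Longrightarrow> n \<ge> P \<Longrightarrow> q \<in> Q \<Longrightarrow> dist (F (k m) q) (F (k n) q) < e/3"
      unfolding eventually_prod_sequentially by auto
    have "dist (F (k m) x) (F (k n) x) < e"
      if x: "x \<in> S" and mn: "m \<ge> max N P" "n \<ge> max N P" for x m n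
    proof -
      obtain q where q: "q \<in> Q" "dist x q < d"
        using Q(3) x by (auto simp: dist_commute)
      have "k m \<ge> N" "k n \<ge> N"
        using mn seq_suble[OF k(1), of m] seq_suble[OF k(1), of n] by auto
      then have "dist (F (k m) x) (F (k m) q) < e/3" "dist (F (k n) x) (F (k n) q) < e/3"
        using N q x Q(1) R(2) by blast+
      moreover have "dist (F (k m) q) (F (k n) q) < e/3"
        using P mn q by auto
      ultimately show ?thesis
        using dist_triangle[of "F (k m) x" "F (k n) x" "F (k m) q"]
          dist_triangle2[of "F (k m) q" "F (k n) x" "F (k n) q"]
        by linarith
    qed
    then show "\<exists>M. \<forall>x\<in>S. \<forall>m\<ge>M. \<forall>n\<ge>M. dist (F (k m) x) (F (k n) x) < e"
      by blast
  qed
  then have "uniformly_convergent_on S (\<lambda>n. F (k n))"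
    by (rule Cauchy_uniformly_convergent)
  then show thesis
    using that k(1) unfolding uniformly_convergent_on_def by blast
qed

section \<open>Negative parts, running maxima, and integrals determined by germs\<close>

lemma neg_part_diff_le: "neg_part a \<le> neg_part b + \<bar>a - b\<bar>"
  by (auto simp: neg_part_def)

lemma is_maximum_insert:
  assumes "is_maximum S v"
  shows "is_maximum (insert a S) (max v a)"
  using assms unfolding is_maximum_def
  by (metis insert_iff linorder_le_cases max.absorb1 max.absorb2 order.trans)

text \<open>Sup-norm nonexpansiveness of the maximum: evaluate each function at the other's
  maximizer. It lets the reflection pass through uniform limits.\<close>

lemma is_maximum_perturb:
  assumes "is_maximum (p ` S) v" "is_maximum (q ` S) w" "\<And>s. s \<in> S \<Longrightarrow> \<bar>p s - q s\<bar> \<le> e"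
  shows "\<bar>v - w\<bar> \<le> e"
proof -
  obtain s t where "s \<in> S" "v = p s" "t \<in> S" "w = q t"
    using assms(1,2) by (auto simp: is_maximum_def)
  moreover have "q s \<le> w" "p t \<le> v"
    using assms(1,2) calculation by (auto simp: is_maximum_def)
  ultimately show ?thesis
    using assms(3)[of s] assms(3)[of t] by auto
qed

lemma norm_vec_le_card:
  fixes v :: "real ^ 'd"
  assumes "\<And>i. \<bar>v $ i\<bar> \<le> c"
  shows "norm v \<le> real CARD('d) * c"
proof -
  have "norm v \<le> (\<Sum>i\<in>UNIV. \<bar>v $ i\<bar>)"
    by (rule norm_le_l1_cart)
  also have "\<dots> \<le> real CARD('d) * c"
    using assms by (intro sum_bounded_above) auto
  finally show ?thesis .
qed

text \<open>Since \<open>W\<close> telescopes over a division, the total error is at most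
  \<open>C * mesh powr (\<theta> - 1) * (b - a)\<close>. Existence and value of the integral come
  out together. The tag \<open>s\<close> ranges over the whole piece because the sums allow
  arbitrary tags.\<close>

lemma has_young_integral_of_germ:
  fixes f :: "real \<Rightarrow> real ^ 'm ^ 'd"
  assumes \<theta>: "1 < \<theta>" and \<Delta>: "0 < \<Delta>" and ab: "a \<le> b" and C: "0 \<le> C"
    and W: "\<And>u s v. a \<le> u \<Longrightarrow> u \<le> s \<Longrightarrow> s \<le> v \<Longrightarrow> v \<le> b \<Longrightarrow> v - u < \<Delta> \<Longrightarrow>
              norm (f s *v (g v - g u) - (W v - W u)) \<le> C * (v - u) powr \<theta>"
  shows "has_young_integral f g a b (W b - W a)"
  unfolding has_young_integral_def
proof (intro allI impI)
  fix e :: real assume e: "0 < e"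
  \<comment> \<open>Solves \<open>(C + 1) * \<eta> powr (\<theta> - 1) * (b - a + 1) = e\<close>;
    the added ones avoid a zero divisor and make the final inequality strict.\<close>
  define \<eta> where "\<eta> = (e / ((C + 1) * (b - a + 1))) powr (1 / (\<theta> - 1))"
  have \<eta>: "\<eta> > 0" "\<eta> powr (\<theta> - 1) = e / ((C + 1) * (b - a + 1))"
    using e C ab \<theta> by (auto simp: \<eta>_def powr_powr)
  have "norm (rs_sum f g p - (W b - W a)) < e"
    if p: "p tagged_division_of {a..b}" "\<And>s k. (s, k) \<in> p \<Longrightarrow> Sup k - Inf k < min \<Delta> \<eta>" for p
  proof -
    have "rs_sum f g p - (W b - W a)
        = (\<Sum>(s, k)\<in>p. f s *v (g (Sup k) - g (Inf k)) - (W (Sup k) - W (Inf k)))"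
      using additive_tagged_division_1[OF ab p(1), of W]
      by (simp add: rs_sum_def sum_subtractf case_prod_unfold)
    also have "norm \<dots> \<le> (\<Sum>(s, k)\<in>p. C * \<eta> powr (\<theta> - 1) * (Sup k - Inf k))"
    proof (rule sum_norm_le, clarify)
      fix s k assume sk: "(s, k) \<in> p"
      obtain u v where k: "k = {u..v}" "s \<in> k" "k \<subseteq> {a..b}"
        using tagged_division_ofD(2-4)[OF p(1) sk] by (metis box_real(2))
      then have uv: "u \<le> s" "s \<le> v" "a \<le> u" "v \<le> b"
        by auto
      have small: "v - u < \<Delta>" "v - u < \<eta>"
        using p(2)[OF sk] k(1) uv by auto
      have "norm (f s *v (g v - g u) - (W v - W u)) \<le> C * (v - u) powr \<theta>"
        using uv small by (intro W) auto
      also have "(v - u) powr \<theta> = (v - u) powr (\<theta> - 1) * (v - u)"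
        using uv by (cases "v = u") (simp_all add: powr_diff)
      also have "(v - u) powr (\<theta> - 1) \<le> \<eta> powr (\<theta> - 1)"
        using uv small \<theta> by (intro powr_mono2) auto
      finally show "norm (f s *v (g (Sup k) - g (Inf k)) - (W (Sup k) - W (Inf k)))
          \<le> C * \<eta> powr (\<theta> - 1) * (Sup k - Inf k)"
        using uv k(1) C by (simp add: mult_left_mono mult_right_mono mult.assoc)
    qed
    also have "\<dots> = C * \<eta> powr (\<theta> - 1) * (b - a)"
      using additive_tagged_division_1[OF ab p(1), of "\<lambda>x. x"]
      by (simp add: case_prod_unfold flip: sum_distrib_left)
    also have "\<dots> = e * ((C * (b - a)) / ((C + 1) * (b - a + 1)))"
      by (simp add: \<eta>)
    also have "\<dots> < e * 1"
    proof (intro mult_strict_left_mono e)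
      have "C * (b - a) < (C + 1) * (b - a + 1)"
        using C ab by (simp add: algebra_simps)
      then show "(C * (b - a)) / ((C + 1) * (b - a + 1)) < 1"
        using C ab by (simp add: divide_less_eq)
    qed
    finally show ?thesis by simp
  qed
  then show "\<exists>\<delta>>0. \<forall>p. p tagged_division_of {a..b} \<and> (\<forall>(s, k)\<in>p. Sup k - Inf k < \<delta>)
      \<longrightarrow> norm (rs_sum f g p - (W b - W a)) < e"
    using \<Delta> \<eta>(1) by (intro exI[of _ "min \<Delta> \<eta>"]) (force simp: case_prod_unfold)
qed

subsection \<open>The reflected Euler scheme\<close>

text \<open>The two inequalities through which the coefficients act on the scheme. The states are
  arbitrary and unrelated to any path: \<open>u = v\<close> in the defect bound yields Lipschitz
  dependence on the state, equal states yield the failure of additivity. Uniformity of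
  \<open>C1\<close> in the state encodes boundedness of the coefficients.\<close>

locale reflected_germ =
  fixes T \<gamma> C1 K2 :: real
    and A :: "real \<Rightarrow> real \<Rightarrow> real ^ 'd \<Rightarrow> real ^ 'd"
    and x0 :: "real ^ 'd"
  assumes T_pos: "0 < T" and gamma: "1 / 2 < \<gamma>"
    and C1_nonneg: "0 \<le> C1" and K2_nonneg: "0 \<le> K2"
    and x0_nonneg: "0 \<le> x0 $ i"
    and germ_bound: "0 \<le> u \<Longrightarrow> u \<le> v \<Longrightarrow> v \<le> T \<Longrightarrow> norm (A u v \<xi>) \<le> C1 * (v - u) powr \<gamma>"
    and germ_defect: "0 \<le> u \<Longrightarrow> u \<le> v \<Longrightarrow> v \<le> w \<Longrightarrow> w \<le> T \<Longrightarrow>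
      norm (A u w \<xi> - A u v \<xi> - A v w \<eta>)
        \<le> K2 * (norm (\<xi> - \<eta>) + (v - u) powr \<gamma>) * (w - v) powr \<gamma>"
begin

lemma germ_refl: "0 \<le> u \<Longrightarrow> u \<le> T \<Longrightarrow> A u u \<xi> = 0"
  using germ_bound[of u u \<xi>] by simp

text \<open>Joint continuity of the germ, deduced from its bound and defect. The ordering is that of
  grid points rounded down, which approach \<open>u\<close> and \<open>v\<close> from the
  left.\<close>

lemma germ_perturb:
  assumes "0 \<le> u'" "u' \<le> u" "u \<le> v" "u' \<le> v'" "v' \<le> v" "v \<le> T"
  shows "norm (A u' v' \<xi>' - A u v \<xi>)
    \<le> K2 * T powr \<gamma> * norm (\<xi>' - \<xi>) + (C1 + K2 * T powr \<gamma>) * ((v - v') powr \<gamma> + (u - u') powr \<gamma>)"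
proof -
  have le_T: "r powr \<gamma> \<le> T powr \<gamma>" if "0 \<le> r" "r \<le> T" for r
    using that gamma by (intro powr_mono2) auto
  have "norm (A u' v' \<xi>' - A u' v' \<xi>) \<le> K2 * norm (\<xi>' - \<xi>) * (v' - u') powr \<gamma>"
    using germ_defect[of u' u' v' \<xi>' \<xi>] assms by (simp add: germ_refl)
  also have "\<dots> \<le> K2 * norm (\<xi>' - \<xi>) * T powr \<gamma>"
    using assms K2_nonneg by (intro mult_left_mono le_T) auto
  finally have 1: "norm (A u' v' \<xi>' - A u' v' \<xi>) \<le> K2 * T powr \<gamma> * norm (\<xi>' - \<xi>)"
    by (simp add: mult_ac)
  have "norm (A u' v \<xi> - A u' v' \<xi> - A v' v \<xi>) \<le> K2 * (v' - u') powr \<gamma> * (v - v') powr \<gamma>"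
    using germ_defect[of u' v' v \<xi> \<xi>] assms by simp
  also have "\<dots> \<le> K2 * T powr \<gamma> * (v - v') powr \<gamma>"
    using assms K2_nonneg by (intro mult_right_mono mult_left_mono le_T) auto
  finally have 2: "norm (A u' v \<xi> - A u' v' \<xi> - A v' v \<xi>) \<le> K2 * T powr \<gamma> * (v - v') powr \<gamma>" .
  have 3: "norm (A v' v \<xi>) \<le> C1 * (v - v') powr \<gamma>"
    using assms by (intro germ_bound) auto
  have "norm (A u' v \<xi> - A u' u \<xi> - A u v \<xi>) \<le> K2 * (u - u') powr \<gamma> * (v - u) powr \<gamma>"
    using germ_defect[of u' u v \<xi> \<xi>] assms by simp
  also have "\<dots> \<le> K2 * (u - u') powr \<gamma> * T powr \<gamma>"
    using assms K2_nonneg by (intro mult_left_mono le_T) auto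
  finally have 4: "norm (A u' v \<xi> - A u' u \<xi> - A u v \<xi>) \<le> K2 * T powr \<gamma> * (u - u') powr \<gamma>"
    by (simp add: mult_ac)
  have 5: "norm (A u' u \<xi>) \<le> C1 * (u - u') powr \<gamma>"
    using assms by (intro germ_bound) auto
  \<comment> \<open>Moves the state, then the right end, then the left end; each move costs one
    defect, and moving an end also costs one short germ.\<close>
  have "A u' v' \<xi>' - A u v \<xi> = (A u' v' \<xi>' - A u' v' \<xi>) - (A u' v \<xi> - A u' v' \<xi> - A v' v \<xi>)
      - A v' v \<xi> + (A u' v \<xi> - A u' u \<xi> - A u v \<xi>) + A u' u \<xi>"
    by simp
  also have "norm \<dots> \<le> norm (A u' v' \<xi>' - A u' v' \<xi>) + norm (A u' v \<xi> - A u' v' \<xi> - A v' v \<xi>)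
      + norm (A v' v \<xi>) + norm (A u' v \<xi> - A u' u \<xi> - A u v \<xi>) + norm (A u' u \<xi>)"
    by (intro norm_triangle_mono norm_triangle_le_diff add_right_mono order.refl)
  finally show ?thesis
    using 1 2 3 4 5 by (simp add: algebra_simps)
qed

text \<open>The pair consists of the unreflected process and the regulator; the germ is evaluated at
  their sum, and the regulator is updated with the new value of \<open>z\<close>.\<close>

primrec euler :: "real \<Rightarrow> nat \<Rightarrow> (real ^ 'd) \<times> (real ^ 'd)" where
  "euler h 0 = (x0, 0)"
| "euler h (Suc k) =
     (let z = fst (euler h k) + A (h * real k) (h * real (Suc k)) (fst (euler h k) + snd (euler h k))
      in (z, \<chi> i. max (snd (euler h k) $ i) (neg_part (z $ i))))"

definition zs :: "real \<Rightarrow> nat \<Rightarrow> real ^ 'd" where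
  "zs h k = fst (euler h k)"

definition ys :: "real \<Rightarrow> nat \<Rightarrow> real ^ 'd" where
  "ys h k = snd (euler h k)"

definition xs :: "real \<Rightarrow> nat \<Rightarrow> real ^ 'd" where
  "xs h k = zs h k + ys h k"

lemma zs_0 [simp]: "zs h 0 = x0" and ys_0 [simp]: "ys h 0 = 0"
  by (simp_all add: zs_def ys_def)

lemma zs_Suc: "zs h (Suc k) = zs h k + A (h * real k) (h * real (Suc k)) (xs h k)"
  by (simp add: zs_def ys_def xs_def Let_def)

lemma ys_Suc: "ys h (Suc k) $ i = max (ys h k $ i) (neg_part (zs h (Suc k) $ i))"
  by (simp add: zs_def ys_def xs_def Let_def)

text \<open>The recursion computes the discrete analogue of the required maximum. Its initial value
  0 is correct because \<open>x0\<close> has no negative part.\<close>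

lemma is_maximum_ys: "is_maximum ((\<lambda>j. neg_part (zs h j $ i)) ` {..k}) (ys h k $ i)"
proof (induction k)
  case 0
  show ?case
    using x0_nonneg[of i] by (simp add: is_maximum_def neg_part_def)
next
  case (Suc k)
  then show ?case
    using is_maximum_insert[OF Suc] by (simp add: ys_Suc atMost_Suc)
qed

text \<open>The regulator is nondecreasing and dominates the negative part at \<open>k\<close>; it
  can rise only to a later negative part, which exceeds that one by at most the oscillation
  \<open>c\<close>.\<close>

lemma ys_diff_le:
  assumes "k \<le> l" "\<And>m. k \<le> m \<Longrightarrow> m \<le> l \<Longrightarrow> \<bar>zs h m $ i - zs h k $ i\<bar> \<le> c"
  shows "\<bar>ys h l $ i - ys h k $ i\<bar> \<le> c"
proof -
  have c: "0 \<le> c"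
    using assms(2)[of k] assms(1) by simp
  have neg: "neg_part (zs h k $ i) \<le> ys h k $ i"
    using is_maximum_ys[of h i k] by (auto simp: is_maximum_def)
  have "ys h k $ i \<le> ys h l $ i \<and> ys h l $ i \<le> ys h k $ i + c"
    using assms
  proof (induction l rule: dec_induct)
    case base
    show ?case using c by simp
  next
    case (step l)
    have "neg_part (zs h (Suc l) $ i) \<le> ys h k $ i + c"
      using neg_part_diff_le[of "zs h (Suc l) $ i" "zs h k $ i"] step.prems[of "Suc l"] step.hyps neg
      by simp
    then show ?case
      using step.IH step.prems by (auto simp: ys_Suc)
  qed
  then show ?thesis
    by auto
qed

text \<open>Sewing applied to the distance between the increment of the scheme and the germ. This
  distance vanishes on single steps by construction, and the cost of a cut is the germ defect at the
  two visited states.\<close>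

lemma euler_remainder:
  assumes h: "0 < h" and M: "1 \<le> M"
    and holder: "\<And>p q. k \<le> p \<Longrightarrow> p < q \<Longrightarrow> q < m \<Longrightarrow>
                  norm (xs h q - xs h p) \<le> M * (h * real (q - p)) powr \<gamma>"
    and km: "k < m" and mT: "h * real m \<le> T"
  shows "norm (zs h m - zs h k - A (h * real k) (h * real m) (xs h k))
    \<le> 2 * sewing_const (2 * \<gamma>) * K2 * M * (h * real (m - k)) powr (2 * \<gamma>)"
proof -
  define r where "r = (\<lambda>p q. norm (zs h q - zs h p - A (h * real p) (h * real q) (xs h p)))"
  \<comment> \<open>Sewing counts indices, so the power of the step is put into \<open>D\<close>.
    The 2 arises because the time term of the defect is absorbed into a second copy of the Hoelder
    term, using \<open>1 \<le> M\<close>.\<close>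
  define D where "D = 2 * K2 * M * h powr (2 * \<gamma>)"
  have "r k m \<le> sewing_const (2 * \<gamma>) * D * real (m - k) powr (2 * \<gamma>)"
  proof (rule discrete_sewing[where a = k and b = m])
    show "1 < 2 * \<gamma>" "0 \<le> D"
      using gamma K2_nonneg M by (auto simp: D_def)
    show "r p (Suc p) \<le> 0" for p
      by (simp add: r_def zs_Suc)
    show "r p w \<le> r p q + r q w + D * real (w - p) powr (2 * \<gamma>)"
      if pqw: "k \<le> p" "p < q" "q < w" "w \<le> m" for p q w
    proof -
      let ?t = "\<lambda>j. h * real j"
      define \<tau> where "\<tau> = ?t w - ?t p"
      have \<tau>: "\<tau> = h * real (w - p)"
        using pqw by (simp add: \<tau>_def of_nat_diff algebra_simps)
      have w: "?t w \<le> T"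
        using mT h pqw by (intro order.trans[OF _ mT]) auto
      have le: "?t p \<le> ?t q" "?t q \<le> ?t w"
        using pqw h by auto
      have pq: "(?t q - ?t p) powr \<gamma> \<le> \<tau> powr \<gamma>" "(?t w - ?t q) powr \<gamma> \<le> \<tau> powr \<gamma>"
        using le gamma by (auto intro!: powr_mono2 simp: \<tau>_def)
      have "norm (xs h p - xs h q) \<le> M * (?t q - ?t p) powr \<gamma>"
        using holder[of p q] pqw by (simp add: norm_minus_commute of_nat_diff algebra_simps)
      also have "\<dots> \<le> M * \<tau> powr \<gamma>"
        using pq M by (intro mult_left_mono) auto
      finally have "norm (xs h p - xs h q) + (?t q - ?t p) powr \<gamma> \<le> M * \<tau> powr \<gamma> + M * \<tau> powr \<gamma>"
        using pq(1) mult_right_mono[OF M, of "\<tau> powr \<gamma>"] by simp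
      then have "K2 * (norm (xs h p - xs h q) + (?t q - ?t p) powr \<gamma>) * (?t w - ?t q) powr \<gamma>
          \<le> K2 * (M * \<tau> powr \<gamma> + M * \<tau> powr \<gamma>) * \<tau> powr \<gamma>"
        using pq K2_nonneg M by (intro mult_mono mult_left_mono) auto
      also have "\<dots> = 2 * K2 * M * (\<tau> powr \<gamma> * \<tau> powr \<gamma>)"
        by (simp add: algebra_simps)
      also have "\<tau> powr \<gamma> * \<tau> powr \<gamma> = \<tau> powr (2 * \<gamma>)"
        by (simp flip: powr_add)
      also have "2 * K2 * M * \<tau> powr (2 * \<gamma>) = D * real (w - p) powr (2 * \<gamma>)"
        using h by (simp add: \<tau> D_def powr_mult)
      finally have "norm (A (?t p) (?t w) (xs h p) - A (?t p) (?t q) (xs h p) - A (?t q) (?t w) (xs h q))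
          \<le> D * real (w - p) powr (2 * \<gamma>)"
        using germ_defect[of "?t p" "?t q" "?t w" "xs h p" "xs h q"] h le w by simp
      moreover have "r p w \<le> r p q + r q w
          + norm (A (?t p) (?t w) (xs h p) - A (?t p) (?t q) (xs h p) - A (?t q) (?t w) (xs h q))"
      proof -
        have eq: "zs h w - zs h p - A (?t p) (?t w) (xs h p)
          = (zs h q - zs h p - A (?t p) (?t q) (xs h p)) + (zs h w - zs h q - A (?t q) (?t w) (xs h q))
            - (A (?t p) (?t w) (xs h p) - A (?t p) (?t q) (xs h p) - A (?t q) (?t w) (xs h q))"
          by simp
        show ?thesis
          unfolding r_def eq by (intro norm_triangle_le_diff add_right_mono norm_triangle_ineq)
      qed
      ultimately show ?thesis
        by simp
    qed
  qed (use km in auto)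
  then show ?thesis
    using h by (simp add: r_def D_def powr_mult mult_ac)
qed

text \<open>The remainder at index \<open>m\<close> involves \<open>xs\<close> only at indices below \<open>m\<close>, so the Hoelder bound
  propagates by induction on the index.\<close>

lemma euler_holder:
  assumes h: "0 < h" and M: "1 \<le> M"
    and window: "(real CARD('d) + 1) * (C1 + 2 * sewing_const (2 * \<gamma>) * K2 * M * \<Delta> powr \<gamma>) \<le> M"
    and "k < l" "h * real l \<le> T" "h * real (l - k) \<le> \<Delta>"
  shows "norm (xs h l - xs h k) \<le> M * (h * real (l - k)) powr \<gamma>"
    and "norm (zs h l - zs h k) \<le> M * (h * real (l - k)) powr \<gamma>"
    and "norm (zs h l - zs h k - A (h * real k) (h * real l) (xs h k))
          \<le> 2 * sewing_const (2 * \<gamma>) * K2 * M * (h * real (l - k)) powr (2 * \<gamma>)"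
proof -
  let ?Cs = "sewing_const (2 * \<gamma>)" and ?n = "real CARD('d)"
  \<comment> \<open>The Hoelder constant that germ plus remainder give for \<open>zs\<close> on a
    window, after trading one factor \<open>\<tau> powr \<gamma>\<close> for
    \<open>\<Delta> powr \<gamma>\<close>.\<close>
  define c where "c = C1 + 2 * ?Cs * K2 * M * \<Delta> powr \<gamma>"
  have Cs: "0 < ?Cs"
    using gamma by (intro sewing_const_pos) auto
  have c: "0 \<le> c" "(?n + 1) * c \<le> M"
    using Cs C1_nonneg K2_nonneg M window by (auto simp: c_def)
  have zs_bound: "norm (zs h l - zs h k) \<le> c * (h * real (l - k)) powr \<gamma>"
    if rem: "norm (zs h l - zs h k - A (h * real k) (h * real l) (xs h k))
          \<le> 2 * ?Cs * K2 * M * (h * real (l - k)) powr (2 * \<gamma>)"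
      and l: "k < l" "h * real l \<le> T" "h * real (l - k) \<le> \<Delta>" for k l
  proof -
    define \<tau> where "\<tau> = h * real (l - k)"
    have \<tau>: "0 < \<tau>" "\<tau> \<le> \<Delta>" "h * real l - h * real k = \<tau>"
      using l h by (auto simp: \<tau>_def of_nat_diff algebra_simps)
    have "norm (A (h * real k) (h * real l) (xs h k)) \<le> C1 * \<tau> powr \<gamma>"
      using germ_bound[of "h * real k" "h * real l" "xs h k"] h l \<tau> by simp
    moreover have "2 * ?Cs * K2 * M * \<tau> powr (2 * \<gamma>) \<le> 2 * ?Cs * K2 * M * (\<Delta> powr \<gamma> * \<tau> powr \<gamma>)"
    proof (rule mult_left_mono)
      have "\<tau> powr (2 * \<gamma>) = \<tau> powr \<gamma> * \<tau> powr \<gamma>"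
        by (simp flip: powr_add)
      also have "\<dots> \<le> \<Delta> powr \<gamma> * \<tau> powr \<gamma>"
        using \<tau> gamma by (intro mult_right_mono powr_mono2) auto
      finally show "\<tau> powr (2 * \<gamma>) \<le> \<Delta> powr \<gamma> * \<tau> powr \<gamma>" .
    qed (use Cs K2_nonneg M in auto)
    ultimately have "norm (zs h l - zs h k) \<le> C1 * \<tau> powr \<gamma> + 2 * ?Cs * K2 * M * (\<Delta> powr \<gamma> * \<tau> powr \<gamma>)"
      using rem norm_triangle_sub[of "zs h l - zs h k" "A (h * real k) (h * real l) (xs h k)"]
      by (simp add: \<tau>_def)
    then show ?thesis
      by (simp add: c_def \<tau>_def algebra_simps)
  qed
  have xs_bound: "norm (xs h l - xs h k) \<le> M * (h * real (l - k)) powr \<gamma>"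
    if "k < l" "h * real l \<le> T" "h * real (l - k) \<le> \<Delta>" for k l
    using that
  proof (induction l arbitrary: k rule: less_induct)
    case (less l)
    define \<tau> where "\<tau> = h * real (l - k)"
    \<comment> \<open>All intermediate indices are needed, not only \<open>l\<close>: the regulator
      sees the oscillation of \<open>zs\<close> over the whole range.\<close>
    have zs: "norm (zs h m - zs h k) \<le> c * \<tau> powr \<gamma>" if m: "k \<le> m" "m \<le> l" for m
    proof (cases "m = k")
      case True
      then show ?thesis using c by simp
    next
      case False
      have hm: "h * real m \<le> T" "h * real (m - k) \<le> \<tau>"
        using m h less.prems by (auto intro!: mult_left_mono order.trans[OF _ less.prems(2)] simp: \<tau>_def)
      have "norm (zs h m - zs h k) \<le> c * (h * real (m - k)) powr \<gamma>"
      proof (intro zs_bound euler_remainder h M)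
        fix p q assume pq: "k \<le> p" "p < q" "q < m"
        then have "h * real q \<le> h * real l" "h * real (q - p) \<le> h * real (l - k)"
          using m h by (auto intro!: mult_left_mono)
        then show "norm (xs h q - xs h p) \<le> M * (h * real (q - p)) powr \<gamma>"
          using pq m less.prems by (intro less.IH) auto
      qed (use m False hm less.prems in \<open>auto simp: \<tau>_def\<close>)
      also have "\<dots> \<le> c * \<tau> powr \<gamma>"
        using hm h c gamma by (intro mult_left_mono powr_mono2) auto
      finally show ?thesis .
    qed
    have "\<bar>(ys h l - ys h k) $ i\<bar> \<le> c * \<tau> powr \<gamma>" for i
      unfolding vector_minus_component
    proof (rule ys_diff_le)
      show "\<bar>zs h m $ i - zs h k $ i\<bar> \<le> c * \<tau> powr \<gamma>" if "k \<le> m" "m \<le> l" for m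
        using zs[OF that] component_le_norm_cart[of "zs h m - zs h k" i] by simp
    qed (use less.prems in auto)
    then have "norm (ys h l - ys h k) \<le> ?n * (c * \<tau> powr \<gamma>)"
      by (rule norm_vec_le_card)
    then have "norm (xs h l - xs h k) \<le> c * \<tau> powr \<gamma> + ?n * (c * \<tau> powr \<gamma>)"
      using zs[of l] less.prems norm_triangle_ineq[of "zs h l - zs h k" "ys h l - ys h k"]
      by (simp add: xs_def algebra_simps)
    \<comment> \<open>One share \<open>c\<close> comes from \<open>zs\<close> and one from each of
      the \<open>?n\<close> components of \<open>ys\<close>; the window condition returns the same
      \<open>M\<close> as in the induction hypothesis.\<close>
    also have "\<dots> = (?n + 1) * c * \<tau> powr \<gamma>"
      by (simp add: algebra_simps)
    also have "\<dots> \<le> M * \<tau> powr \<gamma>"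
      using c by (intro mult_right_mono) auto
    finally show ?case
      by (simp add: \<tau>_def)
  qed
  show rem: "norm (zs h l - zs h k - A (h * real k) (h * real l) (xs h k))
          \<le> 2 * ?Cs * K2 * M * (h * real (l - k)) powr (2 * \<gamma>)"
  proof (intro euler_remainder h M)
    fix p q assume pq: "k \<le> p" "p < q" "q < l"
    then have *: "h * real q \<le> h * real l" "h * real (q - p) \<le> h * real (l - k)"
      using h by (auto intro!: mult_left_mono)
    show "norm (xs h q - xs h p) \<le> M * (h * real (q - p)) powr \<gamma>"
      by (intro xs_bound pq(2) order.trans[OF *(1) assms(5)] order.trans[OF *(2) assms(6)])
  qed (use assms in auto)
  have "norm (zs h l - zs h k) \<le> c * (h * real (l - k)) powr \<gamma>"
    using assms rem by (intro zs_bound) auto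
  also have "c \<le> M"
    using c mult_right_mono[of 1 "?n + 1" c] by simp
  finally show "norm (zs h l - zs h k) \<le> M * (h * real (l - k)) powr \<gamma>"
    by (simp add: mult_right_mono)
  show "norm (xs h l - xs h k) \<le> M * (h * real (l - k)) powr \<gamma>"
    using assms by (intro xs_bound) auto
qed

end

subsection \<open>Passage to the limit\<close>

definition grid_index :: "real \<Rightarrow> real \<Rightarrow> nat" where
  "grid_index h t = nat \<lfloor>t / h\<rfloor>"

lemma grid_index_bounds:
  assumes "0 < h" "0 \<le> t"
  shows "h * real (grid_index h t) \<le> t" "t < h * real (grid_index h t) + h"
proof -
  have "real (grid_index h t) \<le> t / h" "t / h < real (grid_index h t) + 1"
    using assms by (auto simp: grid_index_def)
  then show "h * real (grid_index h t) \<le> t" "t < h * real (grid_index h t) + h"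
    using assms by (auto simp: field_simps)
qed

lemma grid_index_mono:
  assumes "0 < h" "s \<le> t"
  shows "grid_index h s \<le> grid_index h t"
  using assms by (auto simp: grid_index_def intro!: nat_mono floor_mono divide_right_mono)

text \<open>Every index up to the last is attained, at its own grid point. Hence the discrete
  maximum is the running maximum, in continuous time, of the step function built from the
  scheme.\<close>

lemma grid_index_image:
  assumes "0 < h" "0 \<le> t"
  shows "grid_index h ` {0..t} = {..grid_index h t}"
proof
  show "grid_index h ` {0..t} \<subseteq> {..grid_index h t}"
    using assms by (auto intro: grid_index_mono)
  show "{..grid_index h t} \<subseteq> grid_index h ` {0..t}"
  proof
    fix j assume "j \<in> {..grid_index h t}"
    then have "h * real j \<le> h * real (grid_index h t)"
      using assms by simp
    also have "\<dots> \<le> t"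
      by (rule grid_index_bounds(1)[OF assms])
    finally have "h * real j \<in> {0..t}" "grid_index h (h * real j) = j"
      using assms by (auto simp: grid_index_def)
    then show "j \<in> grid_index h ` {0..t}"
      by (metis image_eqI)
  qed
qed

lemma tendsto_grid:
  assumes h: "\<And>n. 0 < h n" "h \<longlonglongrightarrow> 0" and t: "0 \<le> t"
  shows "(\<lambda>n. h n * real (grid_index (h n) t)) \<longlonglongrightarrow> t"
proof (rule tendsto_sandwich)
  show "\<forall>\<^sub>F n in sequentially. t - h n \<le> h n * real (grid_index (h n) t)"
    using grid_index_bounds(2)[OF h(1) t] by (intro always_eventually) (auto simp: less_imp_le diff_le_eq)
  show "\<forall>\<^sub>F n in sequentially. h n * real (grid_index (h n) t) \<le> t"
    using grid_index_bounds(1)[OF h(1) t] by (intro always_eventually) auto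
  show "(\<lambda>n. t - h n) \<longlonglongrightarrow> t"
    using tendsto_diff[OF tendsto_const[of t] h(2)] by simp
qed simp

lemma locally_holder_imp_continuous_on:
  fixes f :: "real \<Rightarrow> 'a::real_normed_vector"
  assumes "0 < \<gamma>" "0 < \<Delta>"
    and f: "\<And>u v. a \<le> u \<Longrightarrow> u \<le> v \<Longrightarrow> v \<le> b \<Longrightarrow> v - u < \<Delta> \<Longrightarrow> norm (f v - f u) \<le> C * (v - u) powr \<gamma>"
  shows "continuous_on {a..b} f"
  unfolding continuous_on_def
proof
  fix x assume x: "x \<in> {a..b}"
  have bound: "norm (f y - f x) \<le> C * \<bar>y - x\<bar> powr \<gamma>" if "y \<in> {a..b}" "\<bar>y - x\<bar> < \<Delta>" for y
    using f[of x y] f[of y x] that x by (cases "x \<le> y") (auto simp: norm_minus_commute)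
  have "((\<lambda>y. C * \<bar>y - x\<bar> powr \<gamma>) \<longlongrightarrow> C * \<bar>x - x\<bar> powr \<gamma>) (at x within {a..b})"
    using assms(1) by (intro tendsto_intros) auto
  then have lim: "((\<lambda>y. C * \<bar>y - x\<bar> powr \<gamma>) \<longlongrightarrow> 0) (at x within {a..b})"
    by simp
  have "\<forall>\<^sub>F y in at x within {a..b}. \<bar>y - x\<bar> < \<Delta>"
    using assms(2) unfolding eventually_at by (auto simp: dist_real_def)
  moreover have "\<forall>\<^sub>F y in at x within {a..b}. y \<in> {a..b}"
    by (simp add: eventually_at_filter)
  ultimately have "\<forall>\<^sub>F y in at x within {a..b}. norm (f y - f x) \<le> C * \<bar>y - x\<bar> powr \<gamma>"
    by eventually_elim (rule bound)
  then have "((\<lambda>y. f y - f x) \<longlongrightarrow> 0) (at x within {a..b})"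
    using lim by (rule Lim_null_comparison)
  then show "(f \<longlongrightarrow> f x) (at x within {a..b})"
    by (simp add: LIM_zero_iff)
qed

lemma continuous_on_neg_part [continuous_intros]:
  "continuous_on S f \<Longrightarrow> continuous_on S (\<lambda>x. neg_part (f x))"
  unfolding neg_part_def by (intro continuous_intros)

lemma running_maximum_exists:
  fixes z :: "real \<Rightarrow> real ^ 'd"
  assumes "continuous_on {0..T} z"
  obtains y where "\<And>t i. t \<in> {0..T} \<Longrightarrow> is_maximum ((\<lambda>s. neg_part (z s $ i)) ` {0..t}) (y t $ i)"
proof -
  have "\<exists>m. is_maximum ((\<lambda>s. neg_part (z s $ i)) ` {0..t}) m" if "t \<in> {0..T}" for t i
  proof -
    have "continuous_on {0..t} (\<lambda>s. neg_part (z s $ i))"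
      using that by (intro continuous_intros continuous_on_subset[OF assms]) auto
    then have "\<exists>s\<in>{0..t}. \<forall>r\<in>{0..t}. neg_part (z r $ i) \<le> neg_part (z s $ i)"
      using continuous_attains_sup[of "{0..t}" "\<lambda>s. neg_part (z s $ i)"] that by auto
    then obtain s where "s \<in> {0..t}" "\<forall>r\<in>{0..t}. neg_part (z r $ i) \<le> neg_part (z s $ i)"
      by blast
    then have "is_maximum ((\<lambda>s. neg_part (z s $ i)) ` {0..t}) (neg_part (z s $ i))"
      by (simp add: is_maximum_def)
    then show ?thesis ..
  qed
  then obtain m where "\<And>t i. t \<in> {0..T} \<Longrightarrow> is_maximum ((\<lambda>s. neg_part (z s $ i)) ` {0..t}) (m t i)"
    by metis
  then show thesis
    using that[of "\<lambda>t. \<chi> i. m t i"] by simp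
qed

section \<open>Window length, bounds for the interpolated scheme, and its limit\<close>

context reflected_germ
begin

text \<open>The order of choice matters: \<open>M\<close> first, so that the germ takes at most half
  of it, then \<open>\<Delta>\<close> so small that the remainder takes at most the other
  half.\<close>

lemma window_exists:
  obtains M \<Delta> where "1 \<le> M" "0 < \<Delta>"
    "(real CARD('d) + 1) * (C1 + 2 * sewing_const (2 * \<gamma>) * K2 * M * \<Delta> powr \<gamma>) \<le> M"
proof -
  define q where "q = real CARD('d) + 1"
  define M where "M = max 1 (2 * q * C1)"
  define P where "P = q * sewing_const (2 * \<gamma>) * K2"
  \<comment> \<open>Gives \<open>2 * P * \<Delta> powr \<gamma> = 2 * P / (4 * P + 1) \<le> 1 /
    2\<close>, also when \<open>P = 0\<close>.\<close>
  define \<Delta> where "\<Delta> = (1 / (4 * P + 1)) powr (1 / \<gamma>)"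
  have P: "0 \<le> P"
    using sewing_const_pos[of "2 * \<gamma>"] gamma K2_nonneg by (simp add: P_def q_def)
  have \<Delta>: "0 < \<Delta>" "\<Delta> powr \<gamma> = 1 / (4 * P + 1)"
    using P gamma by (auto simp: \<Delta>_def powr_powr)
  have M: "1 \<le> M" "2 * q * C1 \<le> M"
    by (auto simp: M_def)
  have "q * (C1 + 2 * sewing_const (2 * \<gamma>) * K2 * M * \<Delta> powr \<gamma>) = q * C1 + M * (2 * P * \<Delta> powr \<gamma>)"
    by (simp add: P_def algebra_simps)
  also have "2 * P * \<Delta> powr \<gamma> \<le> 1 / 2"
    using P by (simp add: \<Delta> field_simps)
  then have "q * C1 + M * (2 * P * \<Delta> powr \<gamma>) \<le> q * C1 + M * (1 / 2)"
    using M by (intro add_left_mono mult_left_mono) auto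
  also have "\<dots> \<le> M"
    using M by simp
  finally show thesis
    using that M \<Delta> by (simp add: q_def)
qed

text \<open>Rounding both times down can lengthen the interval by at most one step; the extra
  \<open>h\<close> disappears in the limit.\<close>

lemma step_bounds:
  assumes h: "0 < h" and M: "1 \<le> M"
    and window: "(real CARD('d) + 1) * (C1 + 2 * sewing_const (2 * \<gamma>) * K2 * M * \<Delta> powr \<gamma>) \<le> M"
    and st: "0 \<le> s" "s \<le> t" "t \<le> T" "t - s + h \<le> \<Delta>"
  defines "k \<equiv> grid_index h s" and "l \<equiv> grid_index h t"
  shows "norm (xs h l - xs h k) \<le> M * (t - s + h) powr \<gamma>"
    and "norm (zs h l - zs h k) \<le> M * (t - s + h) powr \<gamma>"
    and "norm (zs h l - zs h k - A (h * real k) (h * real l) (xs h k))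
          \<le> 2 * sewing_const (2 * \<gamma>) * K2 * M * (t - s + h) powr (2 * \<gamma>)"
proof -
  have kl: "k \<le> l" "h * real k \<le> s" "s < h * real k + h" "h * real l \<le> t"
    using grid_index_mono[OF h st(2)] grid_index_bounds[OF h, of s] grid_index_bounds[OF h, of t] st
    by (auto simp: k_def l_def)
  have C: "0 \<le> 2 * sewing_const (2 * \<gamma>) * K2 * M"
    using sewing_const_pos[of "2 * \<gamma>"] gamma K2_nonneg M by simp
  have \<tau>: "h * real (l - k) \<le> t - s + h"
    using kl by (simp add: of_nat_diff algebra_simps)
  have mono: "(h * real (l - k)) powr e \<le> (t - s + h) powr e" if "0 \<le> e" for e
    using \<tau> h that by (intro powr_mono2) auto
  have "norm (xs h l - xs h k) \<le> M * (h * real (l - k)) powr \<gamma> \<and>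
        norm (zs h l - zs h k) \<le> M * (h * real (l - k)) powr \<gamma> \<and>
        norm (zs h l - zs h k - A (h * real k) (h * real l) (xs h k))
          \<le> 2 * sewing_const (2 * \<gamma>) * K2 * M * (h * real (l - k)) powr (2 * \<gamma>)"
  proof (cases "k = l")
    case True
    then show ?thesis
      using h kl st germ_refl[of "h * real k" "xs h k"] by simp
  next
    case False
    then show ?thesis
      using euler_holder[OF h M window, of k l] kl \<tau> st by simp
  qed
  then show "norm (xs h l - xs h k) \<le> M * (t - s + h) powr \<gamma>"
    "norm (zs h l - zs h k) \<le> M * (t - s + h) powr \<gamma>"
    "norm (zs h l - zs h k - A (h * real k) (h * real l) (xs h k))
          \<le> 2 * sewing_const (2 * \<gamma>) * K2 * M * (t - s + h) powr (2 * \<gamma>)"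
    using order.trans[OF _ mult_left_mono[OF mono[of \<gamma>], of M]]
      order.trans[OF _ mult_left_mono[OF mono[of "2 * \<gamma>"] C]] gamma M
    by simp_all
qed

text \<open>Chaining of \<open>j\<close> half windows. Half of the window is kept free for the
  rounding error \<open>h\<close>, so the bound does not depend on the step.\<close>

lemma step_bounded:
  assumes h: "0 < h" and M: "1 \<le> M"
    and window: "(real CARD('d) + 1) * (C1 + 2 * sewing_const (2 * \<gamma>) * K2 * M * \<Delta> powr \<gamma>) \<le> M"
    and h\<Delta>: "h \<le> \<Delta> / 2" and t: "0 \<le> t" "t \<le> T" "t \<le> real j * (\<Delta> / 2)"
  shows "norm (zs h (grid_index h t) - x0) \<le> real j * (M * \<Delta> powr \<gamma>)"
  using t
proof (induction j arbitrary: t)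
  case 0
  then show ?case by (simp add: grid_index_def)
next
  case (Suc j)
  define s where "s = max 0 (t - \<Delta> / 2)"
  have s: "0 \<le> s" "s \<le> t" "s \<le> T" "s \<le> real j * (\<Delta> / 2)" "t - s + h \<le> \<Delta>"
    using Suc.prems h h\<Delta> by (auto simp: s_def max_def algebra_simps)
  have "norm (zs h (grid_index h t) - zs h (grid_index h s)) \<le> M * (t - s + h) powr \<gamma>"
    using s Suc.prems by (intro step_bounds(2)[OF h M window]) auto
  also have "\<dots> \<le> M * \<Delta> powr \<gamma>"
    using s h M gamma by (intro mult_left_mono powr_mono2) auto
  finally have "norm (zs h (grid_index h t) - zs h (grid_index h s)) \<le> M * \<Delta> powr \<gamma>" .
  moreover have "norm (zs h (grid_index h s) - x0) \<le> real j * (M * \<Delta> powr \<gamma>)"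
    using s by (intro Suc.IH) auto
  ultimately show ?case
    using norm_triangle_ineq[of "zs h (grid_index h t) - zs h (grid_index h s)" "zs h (grid_index h s) - x0"]
    by (simp add: algebra_simps)
qed

text \<open>The limit is described by the germ alone, without integrals, and only by estimates on
  short intervals; these suffice to identify the equation later.\<close>

theorem reflected_germ_solution:
  "\<exists>\<Delta> C (x :: real \<Rightarrow> real ^ 'd) y z. 0 < \<Delta> \<and> 0 \<le> C \<and> z 0 = x0 \<and> (\<forall>t. x t = z t + y t) \<and>
     (\<forall>t\<in>{0..T}. \<forall>i. is_maximum ((\<lambda>s. neg_part (z s $ i)) ` {0..t}) (y t $ i)) \<and>
     (\<forall>u v. 0 \<le> u \<and> u \<le> v \<and> v \<le> T \<and> v - u < \<Delta> \<longrightarrow>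
        norm (x v - x u) \<le> C * (v - u) powr \<gamma> \<and>
        norm (z v - z u - A u v (x u)) \<le> C * (v - u) powr (2 * \<gamma>))"
proof -
  obtain M \<Delta> where M: "1 \<le> M" and \<Delta>: "0 < \<Delta>"
    and window: "(real CARD('d) + 1) * (C1 + 2 * sewing_const (2 * \<gamma>) * K2 * M * \<Delta> powr \<gamma>) \<le> M"
    using window_exists by blast
  define C where "C = 2 * sewing_const (2 * \<gamma>) * K2 * M"
  have C: "0 \<le> C"
    using sewing_const_pos[of "2 * \<gamma>"] gamma K2_nonneg M by (simp add: C_def)
  \<comment> \<open>Starting at half a window makes the uniform bound valid for every
    \<open>n\<close>. The grid need not contain \<open>T\<close>.\<close>
  define h where "h n = \<Delta> / 2 / real (Suc n)" for n
  have h: "0 < h n" "h n \<le> \<Delta> / 2" for n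
    using \<Delta> by (auto simp: h_def field_simps)
  have h_lim: "h \<longlonglongrightarrow> 0"
    unfolding h_def using lim_const_over_n[of "\<Delta> / 2"] by (rule LIMSEQ_Suc)
  define Z where "Z n t = zs (h n) (grid_index (h n) t)" for n t
  obtain j where j: "T \<le> real j * (\<Delta> / 2)"
    using ex_less_of_nat_mult[of "\<Delta> / 2" T] \<Delta> by (auto intro: less_imp_le)
  have "\<exists>d>0. \<exists>N. \<forall>n\<ge>N. \<forall>s\<in>{0..T}. \<forall>t\<in>{0..T}. dist s t < d \<longrightarrow> dist (Z n s) (Z n t) < e"
    if e: "0 < e" for e
  proof -
    \<comment> \<open>Chosen so that \<open>M * \<eta> powr \<gamma> = e / 2\<close>. The half in
      \<open>d\<close> shares \<open>\<eta>\<close> and \<open>\<Delta>\<close> between the distance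
      of the times and the step, the size of the jumps being controlled by the latter.\<close>
    define \<eta> where "\<eta> = (e / (2 * M)) powr (1 / \<gamma>)"
    define d where "d = min \<eta> \<Delta> / 2"
    have \<eta>: "0 < \<eta>" "M * \<eta> powr \<gamma> < e"
      using e M gamma by (auto simp: \<eta>_def powr_powr)
    have d: "0 < d" "2 * d \<le> \<eta>" "2 * d \<le> \<Delta>"
      using \<eta> \<Delta> by (auto simp: d_def)
    obtain N where N: "\<And>n. n \<ge> N \<Longrightarrow> h n < d"
      using order_tendstoD(2)[OF h_lim d(1)] unfolding eventually_sequentially by blast
    have *: "dist (Z n s) (Z n t) < e"
      if "n \<ge> N" "s \<in> {0..T}" "t \<in> {0..T}" "s \<le> t" "dist s t < d" for n s t
    proof -
      have st: "t - s + h n \<le> \<eta>" "t - s + h n \<le> \<Delta>"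
        using N[OF that(1)] d that by (auto simp: dist_real_def)
      have "dist (Z n s) (Z n t) \<le> M * (t - s + h n) powr \<gamma>"
        unfolding Z_def dist_norm
        using st that by (subst norm_minus_commute, intro step_bounds(2)[OF h(1) M window]) auto
      also have "\<dots> \<le> M * \<eta> powr \<gamma>"
        using st that h(1)[of n] M gamma by (intro mult_left_mono powr_mono2) auto
      finally show ?thesis
        using \<eta> by simp
    qed
    have "dist (Z n s) (Z n t) < e"
      if "n \<ge> N" "s \<in> {0..T}" "t \<in> {0..T}" "dist s t < d" for n s t
      using *[of n s t] *[of n t s] that by (cases "s \<le> t") (auto simp: dist_commute)
    then show ?thesis
      using d(1) by blast
  qed
  moreover have "norm (Z n t) \<le> norm x0 + real j * (M * \<Delta> powr \<gamma>)" if "t \<in> {0..T}" for n t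
    using step_bounded[OF h(1) M window h(2), of t j n] that j
      norm_triangle_sub[of "Z n t" x0] by (simp add: Z_def)
  ultimately obtain \<kappa> z where \<kappa>: "strict_mono (\<kappa> :: nat \<Rightarrow> nat)"
    and z: "uniform_limit {0..T} (\<lambda>n. Z (\<kappa> n)) z sequentially"
    using asymptotically_equicontinuous_convergent_subsequence[of "{0..T}" Z] by (metis compact_Icc)
  define H where "H n = h (\<kappa> n)" for n
  have H: "0 < H n" for n
    using h by (simp add: H_def)
  have H_lim: "H \<longlonglongrightarrow> 0"
    using LIMSEQ_subseq_LIMSEQ[OF h_lim \<kappa>] by (simp add: H_def[abs_def] comp_def)
  have z_lim: "(\<lambda>n. zs (H n) (grid_index (H n) t)) \<longlonglongrightarrow> z t" if "t \<in> {0..T}" for t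
    using tendsto_uniform_limitI[OF z that] by (simp add: Z_def H_def)
  \<comment> \<open>The strict inequality on the window leaves room for the vanishing step.\<close>
  have small: "\<forall>\<^sub>F n in sequentially. v - u + H n \<le> \<Delta>" if "v - u < \<Delta>" for u v
    using order_tendstoD(2)[OF H_lim, of "\<Delta> - (v - u)"] that
    by (auto elim!: eventually_mono)
  have powr_lim: "(\<lambda>n. B * (v - u + H n) powr e) \<longlonglongrightarrow> B * (v - u) powr e"
    if "0 < e" "u \<le> v" for B e u v
  proof -
    have "(\<lambda>n. B * (v - u + H n) powr e) \<longlonglongrightarrow> B * (v - u + 0) powr e"
      using that H by (intro tendsto_intros H_lim) (auto intro!: always_eventually simp: less_imp_le)
    then show ?thesis by simp
  qed
  have z_holder: "norm (z v - z u) \<le> M * (v - u) powr \<gamma>"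
    if uv: "0 \<le> u" "u \<le> v" "v \<le> T" "v - u < \<Delta>" for u v
  proof (rule tendsto_le[OF sequentially_bot])
    show "(\<lambda>n. norm (zs (H n) (grid_index (H n) v) - zs (H n) (grid_index (H n) u)))
        \<longlonglongrightarrow> norm (z v - z u)"
      using uv by (intro tendsto_intros z_lim) auto
    show "(\<lambda>n. M * (v - u + H n) powr \<gamma>) \<longlonglongrightarrow> M * (v - u) powr \<gamma>"
      using gamma uv by (intro powr_lim) auto
    show "\<forall>\<^sub>F n in sequentially. norm (zs (H n) (grid_index (H n) v) - zs (H n) (grid_index (H n) u))
        \<le> M * (v - u + H n) powr \<gamma>"
      using small[OF uv(4)] by eventually_elim (use uv in \<open>intro step_bounds(2)[OF H M window]\<close>)
  qed
  have z_cont: "continuous_on {0..T} z"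
    using gamma \<Delta> z_holder by (intro locally_holder_imp_continuous_on[of \<gamma> \<Delta>]) auto
  obtain y where y: "\<And>t i. t \<in> {0..T} \<Longrightarrow> is_maximum ((\<lambda>s. neg_part (z s $ i)) ` {0..t}) (y t $ i)"
    using running_maximum_exists[OF z_cont] by blast
  have y_lim: "(\<lambda>n. ys (H n) (grid_index (H n) t)) \<longlonglongrightarrow> y t" if t: "t \<in> {0..T}" for t
  proof (rule vec_tendstoI)
    fix i
    show "(\<lambda>n. ys (H n) (grid_index (H n) t) $ i) \<longlonglongrightarrow> y t $ i"
    proof (rule tendstoI)
      fix e :: real assume e: "0 < e"
      then have "\<forall>\<^sub>F n in sequentially. \<forall>s\<in>{0..T}. dist (Z (\<kappa> n) s) (z s) < e / 2"
        using uniform_limitD[OF z, of "e / 2"] by simp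
      then show "\<forall>\<^sub>F n in sequentially. dist (ys (H n) (grid_index (H n) t) $ i) (y t $ i) < e"
      proof eventually_elim
        case (elim n)
        have "is_maximum ((\<lambda>s. neg_part (Z (\<kappa> n) s $ i)) ` {0..t}) (ys (H n) (grid_index (H n) t) $ i)"
          using is_maximum_ys[of "H n" i "grid_index (H n) t"] t
          by (simp add: Z_def H_def[symmetric] image_image grid_index_image[OF H, symmetric])
        then have "\<bar>ys (H n) (grid_index (H n) t) $ i - y t $ i\<bar> \<le> e / 2"
        proof (rule is_maximum_perturb[OF _ y[OF t]])
          fix s assume "s \<in> {0..t}"
          then have "dist (Z (\<kappa> n) s) (z s) < e / 2"
            using elim t by auto
          then have "\<bar>Z (\<kappa> n) s $ i - z s $ i\<bar> \<le> e / 2"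
            using component_le_norm_cart[of "Z (\<kappa> n) s - z s" i] by (simp add: dist_norm)
          then show "\<bar>neg_part (Z (\<kappa> n) s $ i) - neg_part (z s $ i)\<bar> \<le> e / 2"
            using neg_part_diff_le[of "Z (\<kappa> n) s $ i" "z s $ i"]
              neg_part_diff_le[of "z s $ i" "Z (\<kappa> n) s $ i"] by linarith
        qed
        then show ?case
          using e by (simp add: dist_real_def)
      qed
    qed
  qed
  define x where "x t = z t + y t" for t
  have x_lim: "(\<lambda>n. xs (H n) (grid_index (H n) t)) \<longlonglongrightarrow> x t" if "t \<in> {0..T}" for t
    unfolding xs_def x_def using that by (intro tendsto_add z_lim y_lim)
  have x_holder: "norm (x v - x u) \<le> M * (v - u) powr \<gamma>"
    if uv: "0 \<le> u" "u \<le> v" "v \<le> T" "v - u < \<Delta>" for u v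
  proof (rule tendsto_le[OF sequentially_bot])
    show "(\<lambda>n. norm (xs (H n) (grid_index (H n) v) - xs (H n) (grid_index (H n) u)))
        \<longlonglongrightarrow> norm (x v - x u)"
      using uv by (intro tendsto_intros x_lim) auto
    show "(\<lambda>n. M * (v - u + H n) powr \<gamma>) \<longlonglongrightarrow> M * (v - u) powr \<gamma>"
      using gamma uv by (intro powr_lim) auto
    show "\<forall>\<^sub>F n in sequentially. norm (xs (H n) (grid_index (H n) v) - xs (H n) (grid_index (H n) u))
        \<le> M * (v - u + H n) powr \<gamma>"
      using small[OF uv(4)] by eventually_elim (use uv in \<open>intro step_bounds(1)[OF H M window]\<close>)
  qed
  have remainder: "norm (z v - z u - A u v (x u)) \<le> C * (v - u) powr (2 * \<gamma>)"
    if uv: "0 \<le> u" "u \<le> v" "v \<le> T" "v - u < \<Delta>" for u v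
  proof -
    let ?k = "\<lambda>t n. grid_index (H n) t"
    let ?t = "\<lambda>t n. H n * real (?k t n)"
    \<comment> \<open>The error supplied by \<open>germ_perturb\<close> when the true end points and
      state replace their grid approximations.\<close>
    let ?E = "\<lambda>n. K2 * T powr \<gamma> * norm (xs (H n) (?k u n) - x u)
        + (C1 + K2 * T powr \<gamma>) * ((v - ?t v n) powr \<gamma> + (u - ?t u n) powr \<gamma>)"
    have grid_le: "0 \<le> ?t u n" "?t u n \<le> u" "?t u n \<le> ?t v n" "?t v n \<le> v" for n
      using H[of n] uv grid_index_bounds(1)[OF H] grid_index_mono[OF H uv(2)]
      by (auto intro!: mult_left_mono)
    have "?E \<longlonglongrightarrow> K2 * T powr \<gamma> * norm (x u - x u)
        + (C1 + K2 * T powr \<gamma>) * ((v - v) powr \<gamma> + (u - u) powr \<gamma>)"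
      using uv gamma grid_le
      by (intro tendsto_intros x_lim tendsto_grid H H_lim) (auto intro!: always_eventually)
    then have E: "?E \<longlonglongrightarrow> 0"
      by simp
    have A_diff: "norm (A (?t u n) (?t v n) (xs (H n) (?k u n)) - A u v (x u)) \<le> ?E n" for n
      using grid_le uv by (intro germ_perturb) auto
    have "(\<lambda>n. A (?t u n) (?t v n) (xs (H n) (?k u n)) - A u v (x u)) \<longlonglongrightarrow> 0"
      by (rule Lim_null_comparison[OF always_eventually[OF allI[OF A_diff]] E])
    then have A_lim: "(\<lambda>n. A (?t u n) (?t v n) (xs (H n) (?k u n))) \<longlonglongrightarrow> A u v (x u)"
      by (simp add: LIM_zero_iff)
    show ?thesis
    proof (rule tendsto_le[OF sequentially_bot])
      show "(\<lambda>n. norm (zs (H n) (?k v n) - zs (H n) (?k u n) - A (?t u n) (?t v n) (xs (H n) (?k u n))))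
          \<longlonglongrightarrow> norm (z v - z u - A u v (x u))"
        using uv by (intro tendsto_intros z_lim A_lim) auto
      show "(\<lambda>n. C * (v - u + H n) powr (2 * \<gamma>)) \<longlonglongrightarrow> C * (v - u) powr (2 * \<gamma>)"
        using gamma uv by (intro powr_lim) auto
      show "\<forall>\<^sub>F n in sequentially.
          norm (zs (H n) (?k v n) - zs (H n) (?k u n) - A (?t u n) (?t v n) (xs (H n) (?k u n)))
            \<le> C * (v - u + H n) powr (2 * \<gamma>)"
        unfolding C_def using small[OF uv(4)]
        by eventually_elim (use uv in \<open>intro step_bounds(3)[OF H M window]\<close>)
    qed
  qed
  have z0: "z 0 = x0"
    using z_lim[of 0] T_pos by (simp add: grid_index_def tendsto_const_iff)
  show ?thesis
  proof (intro exI conjI allI impI ballI)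
    fix u v :: real
    assume uv: "0 \<le> u \<and> u \<le> v \<and> v \<le> T \<and> v - u < \<Delta>"
    then have "norm (x v - x u) \<le> M * (v - u) powr \<gamma>"
      by (intro x_holder) auto
    then show "norm (x v - x u) \<le> max M C * (v - u) powr \<gamma>"
      by (rule order.trans) (simp add: mult_right_mono)
    have "norm (z v - z u - A u v (x u)) \<le> C * (v - u) powr (2 * \<gamma>)"
      using uv by (intro remainder) auto
    then show "norm (z v - z u - A u v (x u)) \<le> max M C * (v - u) powr (2 * \<gamma>)"
      by (rule order.trans) (simp add: mult_right_mono)
  qed (use \<Delta> C y z0 in \<open>auto simp: x_def\<close>)
qed

end

subsection \<open>Existence of a reflected solution\<close>

text \<open>On a bounded interval a larger exponent is traded for a smaller one at the price of a
  power of \<open>T\<close>. This reduces \<open>\<nu>\<close> and the exponent 1 of the drift to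
  \<open>\<gamma>\<close>, and \<open>\<gamma>\<close> to \<open>l\<close>.\<close>

lemma powr_le_scaled_powr:
  fixes r T :: real
  assumes "0 \<le> r" "r \<le> T" "a \<le> b"
  shows "r powr b \<le> T powr (b - a) * r powr a"
proof -
  have "r powr b = r powr (b - a) * r powr a"
    by (simp flip: powr_add)
  also have "\<dots> \<le> T powr (b - a) * r powr a"
    using assms by (intro mult_right_mono powr_mono2) auto
  finally show ?thesis .
qed

lemma holder_spaceE:
  assumes "g \<in> holder_space \<gamma> T V"
  obtains G where "0 \<le> G" "\<And>u v. 0 \<le> u \<Longrightarrow> u \<le> v \<Longrightarrow> v \<le> T \<Longrightarrow> norm (g v - g u) \<le> G * (v - u) powr \<gamma>"
proof -
  obtain M where M: "\<And>u v. 0 \<le> u \<Longrightarrow> u < v \<Longrightarrow> v \<le> T \<Longrightarrow> norm (g v - g u) / (v - u) powr \<gamma> \<le> M"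
    using assms unfolding holder_space_def bdd_above_def by blast
  have "norm (g v - g u) \<le> max M 0 * (v - u) powr \<gamma>" if uv: "0 \<le> u" "u \<le> v" "v \<le> T" for u v
  proof (cases "u = v")
    case False
    then have "norm (g v - g u) \<le> M * (v - u) powr \<gamma>"
      using M[of u v] uv by (simp add: divide_le_eq)
    also have "\<dots> \<le> max M 0 * (v - u) powr \<gamma>"
      by (intro mult_right_mono) auto
    finally show ?thesis .
  qed simp
  then show thesis
    using that[of "max M 0"] by simp
qed

text \<open>Short increments use the local estimate with loss of exponent; for long ones the
  numerator is bounded by compactness and the denominator is at least
  \<open>\<Delta> powr l\<close>.\<close>

lemma locally_holder_imp_holder_space:
  fixes f :: "real \<Rightarrow> 'a::real_normed_vector"
  assumes "0 < l" "l \<le> \<gamma>" "0 < \<Delta>" "0 \<le> C" and V: "f ` {0..T} \<subseteq> V"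
    and f: "\<And>u v. 0 \<le> u \<Longrightarrow> u \<le> v \<Longrightarrow> v \<le> T \<Longrightarrow> v - u < \<Delta> \<Longrightarrow> norm (f v - f u) \<le> C * (v - u) powr \<gamma>"
  shows "f \<in> holder_space l T V"
proof -
  have "continuous_on {0..T} f"
    using assms by (intro locally_holder_imp_continuous_on[of \<gamma> \<Delta>]) auto
  then have "bounded (f ` {0..T})"
    by (intro compact_imp_bounded compact_continuous_image) auto
  then obtain X where X: "\<And>t. t \<in> {0..T} \<Longrightarrow> norm (f t) \<le> X"
    unfolding bounded_iff by (metis imageI)
  have "norm (f v - f u) / (v - u) powr l \<le> max (C * T powr (\<gamma> - l)) (2 * X / \<Delta> powr l)"
    if uv: "0 \<le> u" "u < v" "v \<le> T" for u v
  proof (cases "v - u < \<Delta>")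
    case True
    have "norm (f v - f u) \<le> C * (v - u) powr \<gamma>"
      using f uv True by simp
    also have "\<dots> \<le> C * (T powr (\<gamma> - l) * (v - u) powr l)"
      using assms uv by (intro mult_left_mono powr_le_scaled_powr) auto
    finally show ?thesis
      using uv by (simp add: divide_le_eq le_max_iff_disj mult.assoc)
  next
    case False
    have "norm (f v - f u) \<le> 2 * X"
      using norm_triangle_ineq4[of "f v" "f u"] X[of u] X[of v] uv by simp
    moreover have "\<Delta> powr l \<le> (v - u) powr l"
      using False assms by (intro powr_mono2) auto
    ultimately have "norm (f v - f u) / (v - u) powr l \<le> 2 * X / \<Delta> powr l"
      using assms(3) order.trans[OF norm_ge_zero, of "f v - f u" "2 * X"] by (intro frac_le) auto
    then show ?thesis
      by simp
  qed
  then show ?thesis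
    using V unfolding holder_space_def bdd_above_def by blast
qed

text \<open>Sampling \<open>x\<close> at grid points leaves countably many states, so measurability
  for each fixed state suffices. Continuity in the state then carries measurability to the pointwise
  limit. Rounding down keeps the sample points in \<open>{0..T}\<close>.\<close>

lemma caratheodory_borel_measurable:
  fixes b :: "real \<Rightarrow> 'a::topological_space \<Rightarrow> 'b::metric_space"
  assumes meas: "\<And>x. (\<lambda>t. b t x) \<in> borel_measurable (lebesgue_on {0..T})"
    and cont: "\<And>t. t \<in> {0..T} \<Longrightarrow> continuous_on UNIV (b t)"
    and x: "continuous_on {0..T} x"
  shows "(\<lambda>t. b t (x t)) \<in> borel_measurable (lebesgue_on {0..T})"
proof (rule borel_measurable_LIMSEQ_metric)
  define h where "h n = 1 / real (Suc n)" for n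
  have h: "0 < h n" for n
    by (simp add: h_def)
  have h_lim: "h \<longlonglongrightarrow> 0"
    unfolding h_def[abs_def] using lim_const_over_n[of 1] by (rule LIMSEQ_Suc)
  have "(\<lambda>t. nat \<lfloor>t / h n\<rfloor>) \<in> measurable borel (count_space UNIV)" for n
    by measurable
  then have "grid_index (h n) \<in> measurable (lebesgue_on {0..T}) (count_space UNIV)" for n
    unfolding grid_index_def[abs_def]
    by (intro measurable_restrict_space1 measurable_completion) simp
  then show "(\<lambda>t. b t (x (h n * real (grid_index (h n) t)))) \<in> borel_measurable (lebesgue_on {0..T})" for n
    by (rule measurable_compose_countable[OF meas])
  fix t assume "t \<in> space (lebesgue_on {0..T})"
  then have t: "t \<in> {0..T}"
    by simp
  have grid: "h n * real (grid_index (h n) t) \<in> {0..T}" for n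
    using grid_index_bounds(1)[OF h, of t n] h[of n] t by auto
  have "(\<lambda>n. x (h n * real (grid_index (h n) t))) \<longlonglongrightarrow> x t"
    using t grid by (intro continuous_on_tendsto_compose[OF x] tendsto_grid h h_lim) auto
  then show "(\<lambda>n. b t (x (h n * real (grid_index (h n) t)))) \<longlonglongrightarrow> b t (x t)"
    by (intro continuous_on_tendsto_compose[OF cont[OF t]]) auto
qed

text \<open>Measurability of \<open>b\<close> in time, for each state, spells out what a Lebesgue
  integral in \<open>ds\<close> presupposes; with continuity in the state and boundedness it makes
  the drift integrable along every continuous path.\<close>

theorem theorem4p1:
  fixes T \<gamma> \<nu> l K0 :: real
    and g :: "real \<Rightarrow> real ^ 'm"
    and x0 :: "real ^ 'd"
    and \<sigma> :: "real \<Rightarrow> real ^ 'd \<Rightarrow> real ^ 'm ^ 'd"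
    and b :: "real \<Rightarrow> real ^ 'd \<Rightarrow> real ^ 'd"
  assumes "0 < T"
    and "1 / 2 < \<gamma>" and "\<gamma> \<le> 1"
    and "g \<in> holder_space \<gamma> T UNIV"
    and "\<And>i. 0 < x0 $ i"
    and "bounded {\<sigma> t x | t x. t \<in> {0..T}}"
    and "bounded {b t x | t x. t \<in> {0..T}}"
    and "\<And>x. (\<lambda>t. b t x) \<in> borel_measurable (lebesgue_on {0..T})"
    and "\<gamma> \<le> \<nu>"
    and "\<And>t x y. t \<in> {0..T} \<Longrightarrow> norm (\<sigma> t x - \<sigma> t y) \<le> K0 * norm (x - y)"
    and "\<And>s t x. s \<in> {0..T} \<Longrightarrow> t \<in> {0..T} \<Longrightarrow>
           norm (\<sigma> t x - \<sigma> s x) \<le> K0 * \<bar>t - s\<bar> powr \<nu>"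
    and "\<And>t x y. t \<in> {0..T} \<Longrightarrow> norm (b t x - b t y) \<le> K0 * norm (x - y)"
    and "1 / 2 < l" and "l < \<gamma>"
  shows "\<exists>x \<in> holder_space l T nonneg_orthant. reflected_solution T b \<sigma> g x0 x"
proof -
  define K where "K = \<bar>K0\<bar>"
  have K: "0 \<le> K" "K0 \<le> K"
    by (auto simp: K_def)
  obtain G where G: "0 \<le> G"
    "\<And>u v. 0 \<le> u \<Longrightarrow> u \<le> v \<Longrightarrow> v \<le> T \<Longrightarrow> norm (g v - g u) \<le> G * (v - u) powr \<gamma>"
    using holder_spaceE[OF assms(4)] by blast
  obtain S where S: "\<And>t x. t \<in> {0..T} \<Longrightarrow> norm (\<sigma> t x) \<le> S"
    using assms(6) unfolding bounded_iff by blast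
  obtain B where B: "\<And>t x. t \<in> {0..T} \<Longrightarrow> norm (b t x) \<le> B"
    using assms(7) unfolding bounded_iff by blast
  have S0: "0 \<le> S" and B0: "0 \<le> B"
    using order.trans[OF norm_ge_zero S[of 0]] order.trans[OF norm_ge_zero B[of 0]] assms(1) by auto
  have lip_b: "norm (b t \<xi> - b t \<eta>) \<le> K * norm (\<xi> - \<eta>)" if "t \<in> {0..T}" for t \<xi> \<eta>
    using assms(12)[OF that] mult_right_mono[OF K(2) norm_ge_zero] by (rule order.trans)
  have lip_\<sigma>: "norm (\<sigma> s \<xi> - \<sigma> t \<eta>) \<le> K * norm (\<xi> - \<eta>) + K * T powr (\<nu> - \<gamma>) * \<bar>s - t\<bar> powr \<gamma>"
    if "s \<in> {0..T}" "t \<in> {0..T}" for s t \<xi> \<eta>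
  proof -
    have "norm (\<sigma> s \<xi> - \<sigma> s \<eta>) \<le> K * norm (\<xi> - \<eta>)"
      using assms(10)[OF that(1)] mult_right_mono[OF K(2) norm_ge_zero] by (rule order.trans)
    moreover have "norm (\<sigma> s \<eta> - \<sigma> t \<eta>) \<le> K * \<bar>s - t\<bar> powr \<nu>"
      using assms(11)[OF that(2,1)] mult_right_mono[OF K(2) powr_ge_zero] by (rule order.trans)
    moreover have "K * \<bar>s - t\<bar> powr \<nu> \<le> K * (T powr (\<nu> - \<gamma>) * \<bar>s - t\<bar> powr \<gamma>)"
      using that K assms(9) by (intro mult_left_mono powr_le_scaled_powr) auto
    ultimately show ?thesis
      using norm_triangle_ineq[of "\<sigma> s \<xi> - \<sigma> s \<eta>" "\<sigma> s \<eta> - \<sigma> t \<eta>"] by simp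
  qed
  have integrable: "(\<lambda>s. b s (\<xi> s)) absolutely_integrable_on {0..T}"
    if "continuous_on {0..T} \<xi>" for \<xi>
  proof (rule measurable_bounded_by_integrable_imp_absolutely_integrable)
    have "continuous_on UNIV (b t)" if "t \<in> {0..T}" for t
      using lip_b[OF that] K by (intro lipschitz_on_continuous_on[of K] lipschitz_onI) (auto simp: dist_norm)
    then show "(\<lambda>s. b s (\<xi> s)) \<in> borel_measurable (lebesgue_on {0..T})"
      by (rule caratheodory_borel_measurable[OF assms(8) _ that])
  qed (use B in auto)
  have integrable_sub: "(\<lambda>s. b s (\<xi> s)) integrable_on {u..v}"
    if "continuous_on {0..T} \<xi>" "0 \<le> u" "v \<le> T" for \<xi> u v
    using set_lebesgue_integral_eq_integral(1)[OF integrable[OF that(1)]] that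
    by (rule_tac integrable_on_subinterval) auto
  have integral_le: "norm (integral {u..v} f) \<le> c * T powr (1 - \<gamma>) * (v - u) powr \<gamma>"
    if "0 \<le> u" "u \<le> v" "v \<le> T" "f integrable_on {u..v}" "0 \<le> c" "\<And>s. s \<in> {u..v} \<Longrightarrow> norm (f s) \<le> c"
    for u v c and f :: "real \<Rightarrow> real ^ 'd"
  proof -
    have "norm (integral {u..v} f) \<le> integral {u..v} (\<lambda>_. c)"
      using that by (intro integral_norm_bound_integral) auto
    also have "\<dots> = c * (v - u) powr 1"
      using that by simp
    also have "\<dots> \<le> c * (T powr (1 - \<gamma>) * (v - u) powr \<gamma>)"
      using that assms(3) by (intro mult_left_mono powr_le_scaled_powr) auto
    finally show ?thesis by simp
  qed
  have matvec_le: "norm (P *v (g v - g u)) \<le> p * (G * (v - u) powr \<gamma>)"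
    if "0 \<le> u" "u \<le> v" "v \<le> T" "norm P \<le> p" for P :: "real ^ 'm ^ 'd" and p u v
  proof -
    have "norm (P *v (g v - g u)) \<le> norm P * norm (g v - g u)"
      by (rule norm_matrix_vector_mult_le)
    also have "\<dots> \<le> p * (G * (v - u) powr \<gamma>)"
      using that G order.trans[OF norm_ge_zero that(4)] by (intro mult_mono) auto
    finally show ?thesis .
  qed
  define A where "A u v \<xi> = integral {u..v} (\<lambda>s. b s \<xi>) + \<sigma> u \<xi> *v (g v - g u)" for u v \<xi>
  \<comment> \<open>The three terms are the drift's dependence on the state, that of
    \<open>\<sigma>\<close> on the state, and that of \<open>\<sigma>\<close> on time.\<close>
  define K2 where "K2 = K * T powr (1 - \<gamma>) + K * G * (1 + T powr (\<nu> - \<gamma>))"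
  have const: "(\<lambda>s. b s \<xi>) integrable_on {u..v}" if "0 \<le> u" "v \<le> T" for u v \<xi>
    using integrable_sub[of "\<lambda>_. \<xi>"] that by simp
  interpret reflected_germ T \<gamma> "B * T powr (1 - \<gamma>) + S * G" K2 A x0
  proof
    fix u v w :: real and \<xi> \<eta> :: "real ^ 'd"
    show "norm (A u v \<xi>) \<le> (B * T powr (1 - \<gamma>) + S * G) * (v - u) powr \<gamma>"
      if uv: "0 \<le> u" "u \<le> v" "v \<le> T"
    proof -
      have "norm (integral {u..v} (\<lambda>s. b s \<xi>)) \<le> B * T powr (1 - \<gamma>) * (v - u) powr \<gamma>"
        using uv B B0 const by (intro integral_le) auto
      moreover have "norm (\<sigma> u \<xi> *v (g v - g u)) \<le> S * (G * (v - u) powr \<gamma>)"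
        using uv S by (intro matvec_le) auto
      ultimately have "norm (A u v \<xi>) \<le> B * T powr (1 - \<gamma>) * (v - u) powr \<gamma> + S * (G * (v - u) powr \<gamma>)"
        unfolding A_def by (rule norm_triangle_mono)
      then show ?thesis
        by (simp add: algebra_simps)
    qed
    show "norm (A u w \<xi> - A u v \<xi> - A v w \<eta>)
        \<le> K2 * (norm (\<xi> - \<eta>) + (v - u) powr \<gamma>) * (w - v) powr \<gamma>"
      if uvw: "0 \<le> u" "u \<le> v" "v \<le> w" "w \<le> T"
    proof -
      have "integral {v..w} (\<lambda>s. b s \<xi> - b s \<eta>)
          = integral {v..w} (\<lambda>s. b s \<xi>) - integral {v..w} (\<lambda>s. b s \<eta>)"
        using uvw by (intro integral_diff const) auto
      \<comment> \<open>On \<open>[u,v]\<close> both germs use the same state and cancel; the defect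
        lives on \<open>[v,w]\<close> only, whence its factor
        \<open>(w - v) powr \<gamma>\<close>.\<close>
      then have eq: "A u w \<xi> - A u v \<xi> - A v w \<eta> = integral {v..w} (\<lambda>s. b s \<xi> - b s \<eta>)
          + (\<sigma> u \<xi> - \<sigma> v \<eta>) *v (g w - g v)"
        using Henstock_Kurzweil_Integration.integral_combine[of u v w "\<lambda>s. b s \<xi>"]
          const[of u w \<xi>] uvw
        by (simp add: A_def matrix_vector_mult_diff_rdistrib matrix_vector_mult_diff_distrib algebra_simps)
      have n1: "norm (integral {v..w} (\<lambda>s. b s \<xi> - b s \<eta>))
          \<le> K * norm (\<xi> - \<eta>) * T powr (1 - \<gamma>) * (w - v) powr \<gamma>"
        using uvw K lip_b const by (intro integral_le integrable_diff) auto
      have n2: "norm ((\<sigma> u \<xi> - \<sigma> v \<eta>) *v (g w - g v))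
          \<le> (K * norm (\<xi> - \<eta>) + K * T powr (\<nu> - \<gamma>) * (v - u) powr \<gamma>) * (G * (w - v) powr \<gamma>)"
        using uvw lip_\<sigma>[of u v \<xi> \<eta>] by (intro matvec_le) auto
      have "norm (A u w \<xi> - A u v \<xi> - A v w \<eta>)
          \<le> K * norm (\<xi> - \<eta>) * T powr (1 - \<gamma>) * (w - v) powr \<gamma>
            + (K * norm (\<xi> - \<eta>) + K * T powr (\<nu> - \<gamma>) * (v - u) powr \<gamma>) * (G * (w - v) powr \<gamma>)"
        unfolding eq by (rule norm_triangle_mono[OF n1 n2])
      also have "\<dots> = (K * T powr (1 - \<gamma>) * norm (\<xi> - \<eta>) + K * G * norm (\<xi> - \<eta>)
              + K * G * T powr (\<nu> - \<gamma>) * (v - u) powr \<gamma>) * (w - v) powr \<gamma>"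
        by (simp add: algebra_simps)
      also have "\<dots> \<le> K2 * (norm (\<xi> - \<eta>) + (v - u) powr \<gamma>) * (w - v) powr \<gamma>"
        using K G by (intro mult_right_mono) (auto simp: K2_def algebra_simps)
      finally show ?thesis .
    qed
  next
    show "0 < T" "1 / 2 < \<gamma>"
      by fact+
    show "0 \<le> B * T powr (1 - \<gamma>) + S * G" "0 \<le> K2"
      using G(1) K(1) S0 B0 by (simp_all add: K2_def)
    show "0 \<le> x0 $ i" for i
      using assms(5)[of i] by simp
  qed
  obtain \<Delta> C and x y z :: "real \<Rightarrow> real ^ 'd"
    where \<Delta>: "0 < \<Delta>" and C: "0 \<le> C" and z0: "z 0 = x0" and xzy: "\<forall>t. x t = z t + y t"
    and y: "\<forall>t\<in>{0..T}. \<forall>i. is_maximum ((\<lambda>s. neg_part (z s $ i)) ` {0..t}) (y t $ i)"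
    and local_bounds: "\<forall>u v. 0 \<le> u \<and> u \<le> v \<and> v \<le> T \<and> v - u < \<Delta> \<longrightarrow>
        norm (x v - x u) \<le> C * (v - u) powr \<gamma> \<and>
        norm (z v - z u - A u v (x u)) \<le> C * (v - u) powr (2 * \<gamma>)"
    using reflected_germ_solution by (elim exE conjE) (rule that)
  have x_holder: "norm (x v - x u) \<le> C * (v - u) powr \<gamma>"
    and z_germ: "norm (z v - z u - A u v (x u)) \<le> C * (v - u) powr (2 * \<gamma>)"
    if "0 \<le> u" "u \<le> v" "v \<le> T" "v - u < \<Delta>" for u v
    using local_bounds[rule_format, of u v] that by simp_all
  have x_cont: "continuous_on {0..T} x"
    using assms(2) \<Delta> x_holder by (intro locally_holder_imp_continuous_on[of \<gamma> \<Delta>]) auto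
  define I where "I t = integral {0..t} (\<lambda>s. b s (x s))" for t
  \<comment> \<open>The candidate for the Young integral: what \<open>z\<close> leaves after removal
    of the initial value and the drift. It vanishes at 0.\<close>
  define W where "W t = z t - x0 - I t" for t
  define C' where "C' = (K * C + K * T powr (\<nu> - \<gamma>)) * G + C + K * C * T powr (1 - \<gamma>)"
  have C': "0 \<le> C'"
    using K C G by (simp add: C'_def)
  have W_germ: "norm (\<sigma> s (x s) *v (g v - g u) - (W v - W u)) \<le> C' * (v - u) powr (2 * \<gamma>)"
    if uv: "0 \<le> u" "u \<le> s" "s \<le> v" "v \<le> T" "v - u < \<Delta>" for u s v
  proof -
    define P where "P = (v - u) powr \<gamma>"
    have P: "0 \<le> P" "(v - u) powr (2 * \<gamma>) = P * P"
      by (simp_all add: P_def flip: powr_add)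
    have x_near: "norm (x r - x u) \<le> C * P" if "u \<le> r" "r \<le> v" for r
    proof -
      have "norm (x r - x u) \<le> C * (r - u) powr \<gamma>"
        using that uv by (intro x_holder) auto
      also have "\<dots> \<le> C * P"
        unfolding P_def using that C assms(2) by (intro mult_left_mono powr_mono2) auto
      finally show ?thesis .
    qed
    have "I v - I u = integral {u..v} (\<lambda>r. b r (x r))"
      using Henstock_Kurzweil_Integration.integral_combine[of 0 u v "\<lambda>r. b r (x r)"] integrable_sub[OF x_cont, of 0 v] uv
      by (simp add: I_def algebra_simps)
    moreover have "integral {u..v} (\<lambda>r. b r (x r) - b r (x u))
        = integral {u..v} (\<lambda>r. b r (x r)) - integral {u..v} (\<lambda>r. b r (x u))"
      using uv by (intro integral_diff integrable_sub[OF x_cont] const) auto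
    ultimately have "I v - I u - integral {u..v} (\<lambda>r. b r (x u)) = integral {u..v} (\<lambda>r. b r (x r) - b r (x u))"
      by simp
    then have eq: "\<sigma> s (x s) *v (g v - g u) - (W v - W u) =
        (\<sigma> s (x s) - \<sigma> u (x u)) *v (g v - g u) - (z v - z u - A u v (x u))
          + integral {u..v} (\<lambda>r. b r (x r) - b r (x u))"
      by (simp add: W_def A_def matrix_vector_mult_diff_rdistrib algebra_simps)
    \<comment> \<open>The price of an arbitrary tag \<open>s\<close> instead of the left end:
      \<open>\<sigma>\<close> along \<open>x\<close> changes by order \<open>P\<close>, and so does
      \<open>g\<close>. The bounds \<open>n2\<close> (limit remainder) and \<open>n3\<close>
      (unfreezing the drift) are of order \<open>P * P\<close> as well; \<open>C'\<close> adds the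
      three constants.\<close>
    have n1: "norm ((\<sigma> s (x s) - \<sigma> u (x u)) *v (g v - g u))
        \<le> (K * (C * P) + K * T powr (\<nu> - \<gamma>) * P) * (G * P)"
    unfolding P_def
    proof (rule matvec_le, fold P_def)
      have "norm (\<sigma> s (x s) - \<sigma> u (x u)) \<le> K * norm (x s - x u) + K * T powr (\<nu> - \<gamma>) * \<bar>s - u\<bar> powr \<gamma>"
        using uv by (intro lip_\<sigma>) auto
      also have "\<dots> \<le> K * (C * P) + K * T powr (\<nu> - \<gamma>) * P"
        unfolding P_def using uv K assms(2) x_near[of s]
        by (intro add_mono mult_left_mono powr_mono2) (auto simp: P_def)
      finally show "norm (\<sigma> s (x s) - \<sigma> u (x u)) \<le> K * (C * P) + K * T powr (\<nu> - \<gamma>) * P" .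
    qed (use uv in auto)
    have n2: "norm (z v - z u - A u v (x u)) \<le> C * (P * P)"
      using z_germ[of u v] uv P by simp
    have n3: "norm (integral {u..v} (\<lambda>r. b r (x r) - b r (x u)))
        \<le> K * (C * P) * T powr (1 - \<gamma>) * P"
    unfolding P_def
    proof (rule integral_le, fold P_def)
      show "norm (b r (x r) - b r (x u)) \<le> K * (C * P)" if "r \<in> {u..v}" for r
        using lip_b[of r "x r" "x u"] mult_left_mono[OF x_near[of r] K(1)] that uv by simp
    qed (use uv K C P integrable_sub[OF x_cont] const in \<open>auto intro: integrable_diff\<close>)
    have "norm (\<sigma> s (x s) *v (g v - g u) - (W v - W u))
        \<le> (K * (C * P) + K * T powr (\<nu> - \<gamma>) * P) * (G * P) + C * (P * P)
          + K * (C * P) * T powr (1 - \<gamma>) * P"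
      unfolding eq by (intro norm_triangle_mono norm_triangle_le_diff add_mono n1 n2 n3)
    also have "\<dots> = C' * (v - u) powr (2 * \<gamma>)"
      unfolding P(2) C'_def by (simp add: algebra_simps)
    finally show ?thesis .
  qed
  have young: "has_young_integral (\<lambda>s. \<sigma> s (x s)) g 0 t (W t)" if t: "t \<in> {0..T}" for t
  proof -
    have "has_young_integral (\<lambda>s. \<sigma> s (x s)) g 0 t (W t - W 0)"
      using t assms(2) \<Delta> C' W_germ by (intro has_young_integral_of_germ[of "2 * \<gamma>" \<Delta> _ _ C']) auto
    then show ?thesis
      by (simp add: W_def I_def z0)
  qed
  have z_eq: "z t = x0 + I t + young_integral (\<lambda>s. \<sigma> s (x s)) g 0 t" if "t \<in> {0..T}" for t
    by (simp add: young_integral_eq[OF young[OF that]] W_def)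
  have neg_le: "neg_part (z t $ i) \<le> y t $ i" if "t \<in> {0..T}" for t i
    using y[rule_format, OF that] that by (auto simp: is_maximum_def)
  have "x t \<in> nonneg_orthant" if "t \<in> {0..T}" for t
    unfolding nonneg_orthant_def
  proof (intro CollectI allI)
    \<comment> \<open>The regulator dominates the current negative part, and a number plus its
      negative part is nonnegative.\<close>
    show "0 \<le> x t $ i" for i
      using neg_le[OF that, of i] by (simp add: xzy neg_part_def)
  qed
  then have "x \<in> holder_space l T nonneg_orthant"
    using assms(13,14) \<Delta> C x_holder by (intro locally_holder_imp_holder_space[of l \<gamma> \<Delta> C]) auto
  moreover have "x 0 = x0"
  proof -
    \<comment> \<open>The integral equation is imposed only for positive times, so the initial value
      is checked separately; the maximum over the single time 0 is the negative part of a positive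
      number.\<close>
    have "y 0 $ i = 0" for i
      using y[rule_format, of 0 i] assms(1) assms(5)[of i] by (simp add: is_maximum_def z0 neg_part_def)
    then show ?thesis
      by (simp add: xzy z0 vec_eq_iff)
  qed
  moreover have "reflected_solution T b \<sigma> g x0 x"
    unfolding reflected_solution_def
  proof (intro conjI exI ballI allI)
    show "x 0 = x0" by fact
    show "(\<lambda>s. b s (x s)) absolutely_integrable_on {0..T}"
      by (rule integrable[OF x_cont])
    show "young_integrable (\<lambda>s. \<sigma> s (x s)) g 0 t" if "t \<in> {0..T}" for t
      using young[OF that] by (auto simp: young_integrable_def)
    show "x t = x0 + integral {0..t} (\<lambda>s. b s (x s)) + young_integral (\<lambda>s. \<sigma> s (x s)) g 0 t + y t"
      if "t \<in> {0<..T}" for t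
      using z_eq[of t] that by (simp add: xzy I_def)
    show "z t = x0 + integral {0..t} (\<lambda>s. b s (x s)) + young_integral (\<lambda>s. \<sigma> s (x s)) g 0 t"
      if "t \<in> {0..T}" for t
      using z_eq[OF that] by (simp add: I_def)
  qed (use y in blast)
  ultimately show ?thesis
    by blast
qed

end
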